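(* Let $\mathbb{K}$ be an algebraically closed field of characteristic zero, let $d\ge 3$ be an integer, let $1\le a<b\le d-1$ be integers with $\gcd(a,b,d)=1$, let $e\in\mathbb{K}$ be a primitive $d$-th root of unity, and let $M_{a,b}=\operatorname{diag}(1,e^a,e^b)$, which generates a cyclic group of order $d$ acting on $R=\mathbb{K}[x,y,z]$ by $x\mapsto x$, $y\mapsto e^ay$, $z\mapsto e^bz$. Let $I=I^d_{0,a,b}\subset R$ be the ideal generated by all monomials of degree $d$ that are invariant under the action of $M_{a,b}$. Then $I$ is a minimal GT-system; that is, $I$ is a GT-system (in particular a monomial Togliatti system), and it is minimal as a monomial Togliatti system.
   Context: Let $R=\mathbb{K}[x,y,z]$. Togliatti system: an artinian ideal $J\subset R$ generated by $r$ forms of degree $d$ with $r\le d+1$ is a Togliatti system if it fails the Weak Lefschetz Property in degree $d-1$, i.e. for a general (equivalently, every) linear form $L$ the multiplication map $\times L\colon [R/J]_{d-1}\to[R/J]_d$ does not have maximal rank; under the bound $r\le d+1$ this means that it is not injective. It is a monomial Togliatti system if in addition $J$ can be generated by monomials. A monomial Togliatti system $J$ is minimal if no proper subset of its set of (degree $d$) monomial generators generates an ideal that is a monomial Togliatti system. GT-system (three variables): an ideal generated by all forms of degree $d$ invariant under the action of a diagonal matrix $\operatorname{diag}(e^{\alpha_0},e^{\alpha_1},e^{\alpha_2})$ with $e$ a primitive $d$-th root of unity and $\gcd(\alpha_0,\alpha_1,\alpha_2,d)=1$ (a representation of $\mathbb{Z}/d\mathbb{Z}$), provided its minimal number of generators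 is at most $d+1$. Such an ideal is generated by the invariant monomials of degree $d$ and is a monomial Togliatti system. *)

theory Defs
  imports
    "HOL-Library.Poly_Mapping"
    "HOL-Computational_Algebra.Polynomial"
    "HOL-Algebra.QuotRing"
begin

datatype var = Vx | Vy | Vz

lemma UNIV_var: "UNIV = {Vx, Vy, Vz}"
  using var.exhaust by auto

instance var :: finite
  by standard (simp add: UNIV_var)

text \<open>
  Polynomials in three variables: finitely supported maps from exponent vectors to
  coefficients, with the convolution product of \<^theory>\<open>HOL-Library.Poly_Mapping\<close>.
  The record below presents this type as a ring with carriers, so that ideals, quotient rings
  and cosets are those of HOL-Algebra.
\<close>

type_synonym monom3 = "var \<Rightarrow>\<^sub>0 nat"
type_synonym 'k poly3 = "monom3 \<Rightarrow>\<^sub>0 'k"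

definition polyring :: "'k::field poly3 ring" where
  "polyring = \<lparr>carrier = UNIV, mult = (*), one = 1, zero = 0, add = (+)\<rparr>"

lemma cring_polyring: "cring (polyring :: 'k::field poly3 ring)"
proof (rule cringI)
  show "abelian_group (polyring :: 'k poly3 ring)"
  proof (rule abelian_groupI)
    fix x :: "'k poly3"
    show "\<exists>y\<in>carrier polyring. y \<oplus>\<^bsub>polyring\<^esub> x = \<zero>\<^bsub>polyring\<^esub>"
      by (rule bexI[of _ "- x"]) (simp_all add: polyring_def)
  qed (simp_all add: polyring_def algebra_simps)
  show "comm_monoid (polyring :: 'k poly3 ring)"
    by (rule comm_monoidI) (simp_all add: polyring_def algebra_simps)
qed (simp add: polyring_def algebra_simps)

definition mdeg :: "monom3 \<Rightarrow> nat" where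
  "mdeg m = (\<Sum>v\<in>UNIV. Poly_Mapping.lookup m v)"

text \<open>Forms of degree \<open>n\<close>; the zero polynomial is a form of every degree.\<close>

definition form :: "nat \<Rightarrow> 'k::field poly3 \<Rightarrow> bool" where
  "form n p \<longleftrightarrow> (\<forall>m\<in>Poly_Mapping.keys p. mdeg m = n)"

definition is_monomial :: "'k::field poly3 \<Rightarrow> bool" where
  "is_monomial p \<longleftrightarrow> (\<exists>m. p = Poly_Mapping.single m 1)"

text \<open>
  The graded component of degree \<open>n\<close> of the quotient by \<open>J\<close>, as a set of cosets (for
  homogeneous \<open>J\<close>), and multiplication by the class of \<open>L\<close> in the quotient ring.
\<close>

definition quot_component :: "'k::field poly3 set \<Rightarrow> nat \<Rightarrow> 'k poly3 set set" where
  "quot_component J n = {J +>\<^bsub>polyring\<^esub> f | f. form n f}"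

definition mult_class :: "'k::field poly3 set \<Rightarrow> 'k poly3 \<Rightarrow> 'k poly3 set \<Rightarrow> 'k poly3 set" where
  "mult_class J L u = (J +>\<^bsub>polyring\<^esub> L) \<otimes>\<^bsub>polyring Quot J\<^esub> u"

text \<open>A linear map of finite-dimensional spaces has maximal rank iff it is injective or surjective.\<close>

definition max_rank_at :: "'k::field poly3 set \<Rightarrow> nat \<Rightarrow> 'k poly3 \<Rightarrow> bool" where
  "max_rank_at J n L \<longleftrightarrow>
     inj_on (mult_class J L) (quot_component J n) \<or>
     mult_class J L ` quot_component J n = quot_component J (Suc n)"

text \<open>
  Maximal rank is an open condition on \<open>L\<close>, so over an infinite field a general linear form has
  it iff some linear form does, and failure in degree \<open>n\<close> is failure for every linear form.
\<close>

definition WLP_in_degree :: "'k::field poly3 set \<Rightarrow> nat \<Rightarrow> bool" where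
  "WLP_in_degree J n \<longleftrightarrow> (\<exists>L. form 1 L \<and> max_rank_at J n L)"

definition artinian_ring :: "('a, 'b) ring_scheme \<Rightarrow> bool" where
  "artinian_ring S \<longleftrightarrow> ring S \<and>
     (\<forall>A :: nat \<Rightarrow> 'a set. (\<forall>n. ideal (A n) S \<and> A (Suc n) \<subseteq> A n) \<longrightarrow>
        (\<exists>n. \<forall>m\<ge>n. A m = A n))"

definition artinian_ideal :: "'k::field poly3 set \<Rightarrow> bool" where
  "artinian_ideal J \<longleftrightarrow> ideal J polyring \<and> artinian_ring (polyring Quot J)"

definition togliatti_system :: "nat \<Rightarrow> 'k::field poly3 set \<Rightarrow> bool" where
  "togliatti_system d J \<longleftrightarrow>
     artinian_ideal J \<and>
     (\<exists>F. finite F \<and> card F \<le> d + 1 \<and> (\<forall>f\<in>F. form d f) \<and> J = Idl\<^bsub>polyring\<^esub> F) \<and>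
     \<not> WLP_in_degree J (d - 1)"

definition monomial_togliatti_system :: "nat \<Rightarrow> 'k::field poly3 set \<Rightarrow> bool" where
  "monomial_togliatti_system d J \<longleftrightarrow>
     togliatti_system d J \<and> (\<exists>G. (\<forall>g\<in>G. is_monomial g) \<and> J = Idl\<^bsub>polyring\<^esub> G)"

text \<open>
  A monomial ideal generated in degree \<open>d\<close> has exactly one generating set \<open>G\<close> consisting of
  monomials of degree \<open>d\<close>.
\<close>

definition minimal_monomial_togliatti_system :: "nat \<Rightarrow> 'k::field poly3 set \<Rightarrow> bool" where
  "minimal_monomial_togliatti_system d J \<longleftrightarrow>
     monomial_togliatti_system d J \<and>
     (\<forall>G H. (\<forall>g\<in>G. is_monomial g \<and> form d g) \<and> J = Idl\<^bsub>polyring\<^esub> G \<and> H \<subset> G \<longrightarrow>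
        \<not> monomial_togliatti_system d (Idl\<^bsub>polyring\<^esub> H))"

definition subst :: "(var \<Rightarrow> 'k::field poly3) \<Rightarrow> 'k poly3 \<Rightarrow> 'k poly3" where
  "subst \<sigma> p = (\<Sum>m\<in>Poly_Mapping.keys p.
     Poly_Mapping.single 0 (Poly_Mapping.lookup p m) *
     (\<Prod>v\<in>UNIV. \<sigma> v ^ Poly_Mapping.lookup m v))"

text \<open>The action of the diagonal matrix with entries \<open>c v\<close>: each variable \<open>v\<close> is mapped to \<open>c v * v\<close>.\<close>

definition diag_act :: "(var \<Rightarrow> 'k::field) \<Rightarrow> 'k poly3 \<Rightarrow> 'k poly3" where
  "diag_act c = subst (\<lambda>v. Poly_Mapping.single (Poly_Mapping.single v 1) (c v))"

definition diag_invariant :: "(var \<Rightarrow> 'k::field) \<Rightarrow> 'k poly3 \<Rightarrow> bool" where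
  "diag_invariant c p \<longleftrightarrow> diag_act c p = p"

definition primitive_root_of_unity :: "nat \<Rightarrow> 'k::field \<Rightarrow> bool" where
  "primitive_root_of_unity d e \<longleftrightarrow> 0 < d \<and> e ^ d = 1 \<and> (\<forall>k. 0 < k \<and> k < d \<longrightarrow> e ^ k \<noteq> 1)"

text \<open>Meaningful for finitely generated ideals, hence for every ideal of \<^const>\<open>polyring\<close>.\<close>

definition min_num_generators :: "'k::field poly3 set \<Rightarrow> nat" where
  "min_num_generators J = (LEAST n. \<exists>S. finite S \<and> card S = n \<and> J = Idl\<^bsub>polyring\<^esub> S)"

text \<open>Since \<open>e ^ d = 1\<close>, natural exponents \<open>\<alpha> v\<close> cover all integer exponents.\<close>

definition GT_system :: "nat \<Rightarrow> 'k::field poly3 set \<Rightarrow> bool" where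
  "GT_system d J \<longleftrightarrow>
     (\<exists>(e :: 'k) (\<alpha> :: var \<Rightarrow> nat).
        primitive_root_of_unity d e \<and>
        Gcd {\<alpha> Vx, \<alpha> Vy, \<alpha> Vz, d} = 1 \<and>
        J = Idl\<^bsub>polyring\<^esub> {f. form d f \<and> diag_invariant (\<lambda>v. e ^ \<alpha> v) f}) \<and>
     min_num_generators J \<le> d + 1"

definition invariant_monomial_ideal :: "nat \<Rightarrow> (var \<Rightarrow> 'k::field) \<Rightarrow> 'k poly3 set" where
  "invariant_monomial_ideal d c =
     Idl\<^bsub>polyring\<^esub> {f. is_monomial f \<and> form d f \<and> diag_invariant c f}"

end

theory Submission
  imports Defs "HOL-Number_Theory.Cong" "HOL-Combinatorics.Cycles" "Jordan_Normal_Form.Determinant"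
begin

text \<open>
  For a linear form \<open>L\<close>, its norm, the product of the \<open>d\<close> translates of \<open>L\<close> under the group,
  is an invariant form of degree \<open>d\<close>. Hence multiplication by \<open>L\<close> from degree \<open>d - 1\<close> to degree
  \<open>d\<close> of the quotient by the ideal of invariants is not injective, and by counting dimensions
  (there are at most \<open>d + 1\<close> generators) not surjective either.

  For minimality take \<open>L = x + y + z\<close>. If \<open>L * f\<close> lies in the span of some of the invariant
  monomials, then it is divisible by all translates of \<open>L\<close> and so is a multiple of the norm of
  \<open>L\<close>. It remains to see that every invariant monomial occurs in this norm. The norm is the
  determinant of a circulant matrix with three nonzero entries \<open>x\<close>, \<open>y\<close>, \<open>z\<close> in each row, so
  its coefficients are signed counts of the permutations of the integers modulo \<open>d\<close> that move
  every point by \<open>0\<close>, \<open>a\<close> or \<open>b\<close>. The trajectories of such a permutation are disjoint lattice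
  paths on a torus; they cannot cross, hence are parallel, so all nontrivial cycles have the
  same length, determined by the numbers of steps of each kind. Therefore permutations
  contributing to the same monomial have the same sign, and there is no cancellation.
\<close>

subsection \<open>Permutations moving points by two fixed steps\<close>

locale circulant_steps =
  fixes d a b :: nat
  assumes a_pos: "0 < a" and a_less_b: "a < b" and b_less_d: "b < d"
    and coprime_abd: "Gcd {a, b, d} = 1"
begin

lemma mod_add_neq:
  assumes "i < d" "0 < c" "c < d"
  shows "(i + c) mod d \<noteq> i"
proof
  assume "(i + c) mod d = i"
  then have "(i + c) mod d = (i + 0) mod d" using assms by simp
  then have "d dvd c"
    using assms(1) by (metis cong_def cong_add_lcancel_nat cong_0_iff)
  then show False using assms by (auto dest: dvd_imp_le)
qed

lemma add_mod_neq: "i < d \<Longrightarrow> (i + a) mod d \<noteq> i" "i < d \<Longrightarrow> (i + b) mod d \<noteq> i"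
    "(i + a) mod d \<noteq> (i + b) mod d"
proof -
  show "i < d \<Longrightarrow> (i + a) mod d \<noteq> i" "i < d \<Longrightarrow> (i + b) mod d \<noteq> i"
    using mod_add_neq[of i] a_pos a_less_b b_less_d by auto
  show "(i + a) mod d \<noteq> (i + b) mod d"
  proof
    assume "(i + a) mod d = (i + b) mod d"
    then have "[a = b] (mod d)" using cong_add_lcancel_nat cong_def by blast
    then show False using a_less_b b_less_d cong_less_modulus_unique_nat[of a b d] by auto
  qed
qed

text \<open>Any two residues modulo \<open>d\<close> are thus joined by a lattice vector in the
  steps \<open>a\<close> and \<open>b\<close>; this is how the gcd condition lets arbitrary
  trajectories be compared.\<close>

lemma bezout_level: "\<exists>x y :: int. [c = int a * x + int b * y] (mod int d)"
proof -
  have "gcd (gcd (int a) (int b)) (int d) = int (Gcd {a, b, d})"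
    by (simp add: gcd.assoc)
  then have "gcd (gcd (int a) (int b)) (int d) = 1" using coprime_abd by simp
  then obtain z w where zw: "z * gcd (int a) (int b) + w * int d = 1"
    using bezout_int by metis
  obtain x y where xy: "x * int a + y * int b = gcd (int a) (int b)"
    using bezout_int by blast
  have "c = c * (z * gcd (int a) (int b) + w * int d)" using zw by simp
  also have "\<dots> = int a * (c * z * x) + int b * (c * z * y) + int d * (c * w)"
    unfolding xy[symmetric] by (simp add: algebra_simps)
  finally have "c - (int a * (c * z * x) + int b * (c * z * y)) = int d * (c * w)"
    by linarith
  then have "[c = int a * (c * z * x) + int b * (c * z * y)] (mod int d)"
    by (simp add: cong_iff_dvd_diff)
  then show ?thesis by blast
qed

end

section \<open>Trajectories of hopping permutations\<close>

locale hopping_permutation = circulant_steps +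
  fixes p :: "nat \<Rightarrow> nat"
  assumes perm: "p permutes {0..<d}"
    and hop: "\<And>i. i < d \<Longrightarrow> p i = i \<or> p i = (i + a) mod d \<or> p i = (i + b) mod d"
begin

definition moved :: "nat set" where "moved = {i. i < d \<and> p i \<noteq> i}"

definition long_hop :: "nat \<Rightarrow> int" where
  "long_hop i = (if p i = (i + b) mod d then 1 else 0)"

definition long_hops :: "nat \<Rightarrow> nat \<Rightarrow> int" where
  "long_hops i n = (\<Sum>k<n. long_hop ((p ^^ k) i))"

lemma moved_less: "i \<in> moved \<Longrightarrow> i < d" by (simp add: moved_def)

lemma finite_moved [simp]: "finite moved" by (simp add: moved_def)

lemma funpow_permutes: "(p ^^ n) permutes {0..<d}"
  using perm by (simp add: permutes_funpow)

lemma inj_funpow: "inj (p ^^ n)"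
  using funpow_permutes permutes_inj by blast

lemma funpow_moved [simp]: "i \<in> moved \<Longrightarrow> (p ^^ n) i \<in> moved"
proof -
  assume i: "i \<in> moved"
  have "(p ^^ n) i < d" using funpow_permutes[of n] i permutes_in_image[of "p ^^ n" "{0..<d}" i] by (simp add: moved_def)
  moreover have "p ((p ^^ n) i) \<noteq> (p ^^ n) i"
    using i injD[OF inj_funpow, of n "p i" i] by (auto simp: moved_def funpow_swap1)
  ultimately show ?thesis by (simp add: moved_def)
qed

lemma long_hop_bounds: "0 \<le> long_hop i" "long_hop i \<le> 1"
  by (auto simp: long_hop_def)

lemma long_hops_bounds: "0 \<le> long_hops i n" "long_hops i n \<le> int n"
proof -
  show "0 \<le> long_hops i n" by (simp add: long_hops_def sum_nonneg long_hop_bounds)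
  show "long_hops i n \<le> int n"
    using sum_mono[of "{..<n}" "\<lambda>k. long_hop ((p ^^ k) i)" "\<lambda>_. 1"]
    by (simp add: long_hops_def long_hop_bounds)
qed

lemma long_hops_0 [simp]: "long_hops i 0 = 0" by (simp add: long_hops_def)

lemma long_hops_Suc: "long_hops i (Suc n) = long_hops i n + long_hop ((p ^^ n) i)"
  by (simp add: long_hops_def)

lemma long_hops_add: "long_hops i (m + n) = long_hops i m + long_hops ((p ^^ m) i) n"
proof (induction n)
  case (Suc n)
  then show ?case by (simp add: long_hops_Suc funpow_add add.commute[of m])
qed simp

lemma long_hops_period:
  assumes "(p ^^ n) i = i"
  shows "long_hops i (k * n) = int k * long_hops i n"
proof (induction k)
  case (Suc k)
  then show ?case using assms by (simp add: long_hops_add algebra_simps)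
qed simp

text \<open>A moved point stays moved, so it takes a step \<open>a\<close> or \<open>b\<close> at
  every time. Time \<open>n\<close> and the count \<open>long_hops i n\<close> therefore act as the
  two coordinates of its lattice path.\<close>

lemma position:
  assumes "i \<in> moved"
  shows "[int ((p ^^ n) i) = int i + int a * int n + (int b - int a) * long_hops i n] (mod int d)"
proof (induction n)
  case (Suc n)
  let ?j = "(p ^^ n) i"
  have j: "?j \<in> moved" using assms by simp
  have "[int (p ?j) = int ?j + int a + (int b - int a) * long_hop ?j] (mod int d)"
  proof (cases "p ?j = (?j + b) mod d")
    case True
    then show ?thesis by (simp add: long_hop_def cong_def zmod_int)
  next
    case False
    then have "p ?j = (?j + a) mod d" using hop[of ?j] j by (auto simp: moved_def)
    then show ?thesis using False by (simp add: long_hop_def cong_def zmod_int)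
  qed
  also have "[int ?j + int a + (int b - int a) * long_hop ?j =
      int i + int a * int n + (int b - int a) * long_hops i n + int a + (int b - int a) * long_hop ?j] (mod int d)"
    by (intro cong_add Suc cong_refl)
  finally show ?case by (simp add: long_hops_Suc algebra_simps)
qed simp

lemma cong_imp_eq: "i < d \<Longrightarrow> j < d \<Longrightarrow> [int i = int j] (mod int d) \<Longrightarrow> i = j"
  by (simp add: cong_int_iff cong_less_modulus_unique_nat)

text \<open>At equality, \<open>position\<close> would put both points at the same residue at time
  \<open>n\<close>, against the injectivity of \<open>p ^^ n\<close>. Every integer \<open>q\<close>
  satisfying the congruence is thus a forbidden difference.\<close>

lemma never_meet:
  assumes "i \<in> moved" "j \<in> moved" "i \<noteq> j"
    and lev: "[int j = int i + (int b - int a) * q] (mod int d)"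
  shows "long_hops i n - long_hops j n \<noteq> q"
proof
  assume eq: "long_hops i n - long_hops j n = q"
  have "[int ((p ^^ n) j) = int j + int a * int n + (int b - int a) * long_hops j n] (mod int d)"
    by (rule position) fact
  also have "[int j + int a * int n + (int b - int a) * long_hops j n =
     int i + (int b - int a) * q + int a * int n + (int b - int a) * long_hops j n] (mod int d)"
    by (intro cong_add lev cong_refl)
  also have "int i + (int b - int a) * q + int a * int n + (int b - int a) * long_hops j n =
     int i + int a * int n + (int b - int a) * long_hops i n"
    unfolding eq[symmetric] by (simp add: algebra_simps)
  also have "[\<dots> = int ((p ^^ n) i)] (mod int d)"
    by (rule cong_sym[OF position]) fact
  finally have "(p ^^ n) j = (p ^^ n) i"
    using assms moved_less funpow_moved by (blast intro: cong_imp_eq)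
  then show False using assms(3) injD[OF inj_funpow] by metis
qed

text \<open>
  Discrete intermediate value theorem: the difference changes by at most one per step, so it
  cannot jump over the forbidden value \<open>q\<close>.
\<close>

lemma stays_below:
  assumes "i \<in> moved" "j \<in> moved" "i \<noteq> j" "0 < q"
    and "[int j = int i + (int b - int a) * q] (mod int d)"
  shows "long_hops i n - long_hops j n < q"
proof (induction n)
  case (Suc n)
  have "long_hops i (Suc n) - long_hops j (Suc n) \<noteq> q"
    using never_meet assms by blast
  then show ?case
    using Suc long_hop_bounds[of "(p ^^ n) i"] long_hop_bounds[of "(p ^^ n) j"]
    by (simp add: long_hops_Suc)
qed (use assms in simp)

text \<open>The mirror image of \<open>stays_below\<close>: exchange the two points and replace
  \<open>q\<close> by \<open>- q\<close>.\<close>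

lemma stays_above:
  assumes "i \<in> moved" "j \<in> moved" "i \<noteq> j" "q < 0"
    and lev: "[int j = int i + (int b - int a) * q] (mod int d)"
  shows "q < long_hops i n - long_hops j n"
proof -
  have "[int j + (int b - int a) * (- q) = int i + (int b - int a) * q + (int b - int a) * (- q)] (mod int d)"
    by (intro cong_add lev cong_refl)
  then have "[int i = int j + (int b - int a) * (- q)] (mod int d)"
    by (simp add: cong_sym)
  then show ?thesis using stays_below[of j i "- q" n] assms by simp
qed

text \<open>Adding multiples of \<open>d\<close> to \<open>q\<close> keeps the congruence. So there
  are forbidden values of both signs, and the difference, which starts at 0, is trapped between
  them.\<close>

lemma bounded_same_level:
  assumes "i \<in> moved" "j \<in> moved"
    and lev: "[int j = int i + (int b - int a) * q] (mod int d)"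
  shows "\<exists>B. \<forall>n. \<bar>long_hops i n - long_hops j n\<bar> \<le> B"
proof (cases "i = j")
  case False
  have shift: "[int j = int i + (int b - int a) * (q + int d * m)] (mod int d)" for m
  proof -
    have "[int i + (int b - int a) * q + 0 = int i + (int b - int a) * q + int d * ((int b - int a) * m)] (mod int d)"
      by (intro cong_add cong_refl) (simp add: cong_def)
    then show ?thesis using cong_trans[OF lev] by (simp add: algebra_simps)
  qed
  have d1: "1 \<le> int d" using b_less_d by simp
  have dq: "\<bar>q\<bar> + 1 \<le> int d * (\<bar>q\<bar> + 1)"
    using mult_right_mono[OF d1, of "\<bar>q\<bar> + 1"] by simp
  define q1 where "q1 = q + int d * (\<bar>q\<bar> + 1)"
  define q2 where "q2 = q + int d * (- (\<bar>q\<bar> + 1))"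
  have "0 < q1" "q2 < 0" unfolding q1_def q2_def mult_minus_right using dq by linarith+
  then have lt: "long_hops i n - long_hops j n < q1" and gt: "q2 < long_hops i n - long_hops j n" for n
    using stays_below[OF assms(1,2) False _ shift] stays_above[OF assms(1,2) False _ shift]
    by (auto simp: q1_def q2_def)
  have "\<bar>long_hops i n - long_hops j n\<bar> \<le> \<bar>q1\<bar> + \<bar>q2\<bar>" for n
    using lt[of n] gt[of n] by linarith
  then show ?thesis by blast
qed auto

text \<open>Letting \<open>i\<close> run for a suitable time \<open>s\<close> makes its offset from
  \<open>j\<close> a multiple of \<open>b - a\<close>, so that \<open>bounded_same_level\<close>
  applies; the delay changes the difference by at most \<open>s\<close>.\<close>

lemma bounded:
  assumes "i \<in> moved" "j \<in> moved"
  shows "\<exists>B. \<forall>n. \<bar>long_hops i n - long_hops j n\<bar> \<le> B"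
proof -
  obtain x0 y where xy: "[int j - int i = int a * x0 + int b * y] (mod int d)"
    using bezout_level by blast
  \<comment> \<open>The Bezout coefficient of \<open>a\<close> is raised by a multiple of
    \<open>d\<close> so that \<open>x + y\<close>, the number of steps, becomes a natural
    number.\<close>
  define x where "x = x0 + int d * \<bar>x0 + y\<bar>"
  have "\<bar>x0 + y\<bar> \<le> int d * \<bar>x0 + y\<bar>" using b_less_d mult_right_mono[of 1 "int d" "\<bar>x0 + y\<bar>"] by simp
  then have "0 \<le> x + y" by (simp add: x_def)
  then obtain s where s: "int s = x + y" using nonneg_int_cases by metis
  let ?i = "(p ^^ s) i"
  have x: "[int a * x0 + int b * y = int a * x + int b * y] (mod int d)"
    by (auto simp: x_def cong_iff_dvd_diff algebra_simps)
  have "[int j - int i - (int ?i - int i) = int a * x + int b * y - (int a * int s + (int b - int a) * long_hops i s)] (mod int d)"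
    using position[OF assms(1), of s] by (intro cong_diff cong_trans[OF xy x]) (simp add: cong_iff_dvd_diff algebra_simps)
  then have "[int j = int ?i + (int b - int a) * (y - long_hops i s)] (mod int d)"
    unfolding s by (simp add: cong_iff_dvd_diff algebra_simps)
  then obtain B where B: "\<And>n. \<bar>long_hops ?i n - long_hops j n\<bar> \<le> B"
    using bounded_same_level[of ?i j] assms funpow_moved by blast
  have "\<bar>long_hops i n - long_hops j n\<bar> \<le> B + int s" for n
  proof -
    have "long_hops i s + long_hops ?i n = long_hops i n + long_hops ((p ^^ n) i) s"
      using long_hops_add[of i s n] long_hops_add[of i n s] by (simp add: add.commute)
    then show ?thesis
      using B[of n] long_hops_bounds[of i s] long_hops_bounds[of "(p ^^ n) i" s] by linarith
  qed
  then show ?thesis by blast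
qed

text \<open>Over \<open>m\<close> periods of length \<open>K\<close> the difference is
  \<open>m\<close> times its value at \<open>K\<close>, so boundedness forces this value to vanish:
  the paths are parallel.\<close>

lemma long_hops_eq:
  assumes "i \<in> moved" "j \<in> moved" and K: "p ^^ K = id"
  shows "long_hops i K = long_hops j K"
proof (rule ccontr)
  assume "long_hops i K \<noteq> long_hops j K"
  then have ge: "1 \<le> \<bar>long_hops i K - long_hops j K\<bar>" by linarith
  obtain B where B: "\<And>n. \<bar>long_hops i n - long_hops j n\<bar> \<le> B"
    using bounded[OF assms(1,2)] by blast
  have B0: "0 \<le> B" using B[of 0] by simp
  let ?m = "nat (B + 1)"
  have "\<bar>int ?m * (long_hops i K - long_hops j K)\<bar> \<le> B"
    using B[of "?m * K"] long_hops_period[of K i ?m] long_hops_period[of K j ?m] K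
    by (simp only: id_apply right_diff_distrib)
  moreover have "int ?m * 1 \<le> int ?m * \<bar>long_hops i K - long_hops j K\<bar>"
    by (rule mult_left_mono[OF ge]) simp
  ultimately show False using B0 ge by (simp add: abs_mult distrib_right)
qed

lemma sum_long_hop_moved: "(\<Sum>i\<in>moved. long_hop ((p ^^ k) i)) = int (card {i. i < d \<and> p i = (i + b) mod d})"
proof -
  have sub: "(p ^^ k) ` moved \<subseteq> moved" by auto
  have "bij_betw (p ^^ k) moved moved"
    unfolding bij_betw_def using inj_on_subset[OF inj_funpow] endo_inj_surj[OF finite_moved sub] by blast
  then have "(\<Sum>i\<in>moved. long_hop ((p ^^ k) i)) = (\<Sum>i\<in>moved. long_hop i)"
    by (rule sum.reindex_bij_betw)
  also have "\<dots> = int (card (moved \<inter> {i. p i = (i + b) mod d}))"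
    by (simp add: long_hop_def sum.If_cases)
  also have "moved \<inter> {i. p i = (i + b) mod d} = {i. i < d \<and> p i = (i + b) mod d}"
    using mod_add_neq[of _ b] a_pos a_less_b b_less_d by (fastforce simp: moved_def)
  finally show ?thesis .
qed

text \<open>Double counting of long hops: at each time \<open>k\<close> the map
  \<open>p ^^ k\<close> permutes \<open>moved\<close>, so the same number of long hops is made at
  every time, while all moved points contribute equally by \<open>long_hops_eq\<close>.\<close>

lemma slope:
  assumes "i \<in> moved" and K: "p ^^ K = id"
  shows "int (card moved) * long_hops i K = int K * int (card {i. i < d \<and> p i = (i + b) mod d})"
proof -
  have "int (card moved) * long_hops i K = (\<Sum>j\<in>moved. long_hops j K)"
    using long_hops_eq[OF _ assms(1) K] by simp
  also have "\<dots> = (\<Sum>k<K. \<Sum>j\<in>moved. long_hop ((p ^^ k) j))"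
    unfolding long_hops_def by (rule sum.swap)
  finally show ?thesis by (simp add: sum_long_hop_moved)
qed

text \<open>
  The right-hand side depends on \<open>p\<close> only through its number of hops of each kind.
\<close>

lemma return_iff:
  assumes i: "i \<in> moved"
  shows "(p ^^ N) i = i \<longleftrightarrow>
    (\<exists>U. int (card moved) * U = int N * int (card {i. i < d \<and> p i = (i + b) mod d}) \<and>
         int d dvd int a * int N + (int b - int a) * U)"
    (is "_ \<longleftrightarrow> (\<exists>U. ?n * U = _ * ?c \<and> _)")
proof -
  have "permutation p" using perm by (auto simp: permutation_permutes)
  then obtain K where K: "p ^^ K = id" "0 < K" using permutation_is_nilpotent by blast
  have KK: "(p ^^ K) i = i" using K by simp
  have n0: "?n \<noteq> 0" using i by auto
  show ?thesis
  proof
    assume N: "(p ^^ N) i = i"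
    have "int K * long_hops i N = int N * long_hops i K"
      using long_hops_period[OF N, of K] long_hops_period[OF KK, of N] by (simp add: mult.commute)
    then have "?n * (int K * long_hops i N) = int N * (?n * long_hops i K)"
      by (simp only: mult.left_commute)
    then have "int K * (?n * long_hops i N) = int K * (int N * ?c)"
      unfolding slope[OF i K(1)] by (simp only: mult.left_commute)
    then have 1: "?n * long_hops i N = int N * ?c" using K(2) by simp
    have "[int i = int i + int a * int N + (int b - int a) * long_hops i N] (mod int d)"
      using position[OF i, of N] N by simp
    then have "int d dvd int a * int N + (int b - int a) * long_hops i N"
      by (simp add: cong_iff_dvd_diff algebra_simps dvd_diff_commute)
    with 1 show "\<exists>U. ?n * U = int N * ?c \<and> int d dvd int a * int N + (int b - int a) * U" by blast
  next
    assume "\<exists>U. ?n * U = int N * ?c \<and> int d dvd int a * int N + (int b - int a) * U"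
    then obtain U where U: "?n * U = int N * ?c" "int d dvd int a * int N + (int b - int a) * U" by blast
    let ?i = "(p ^^ N) i"
    have i': "?i \<in> moved" using i by simp
    \<comment> \<open>The condition on \<open>U\<close> says that \<open>?i\<close> is offset from
      \<open>i\<close> by \<open>long_hops i N - U\<close> units of \<open>b - a\<close>; if the two
      points differ, this is a forbidden difference.\<close>
    have "int ?i - (int i + (int b - int a) * (long_hops i N - U)) =
       (int ?i - (int i + int a * int N + (int b - int a) * long_hops i N)) + (int a * int N + (int b - int a) * U)"
      by (simp add: algebra_simps)
    then have lev: "[int ?i = int i + (int b - int a) * (long_hops i N - U)] (mod int d)"
      using position[OF i, of N] U(2) by (simp only: cong_iff_dvd_diff dvd_add)
    have "?n * (int N * long_hops i K) = int N * (?n * long_hops i K)" by (rule mult.left_commute)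
    also have "\<dots> = int K * (?n * U)"
      unfolding slope[OF i K(1)] U(1) by (rule mult.left_commute)
    finally have "?n * (int N * long_hops i K) = ?n * (int K * U)" by (simp only: mult.left_commute)
    then have KU: "int N * long_hops i K = int K * U" using n0 by simp
    then have total: "long_hops i (K * N) = int K * U"
      using long_hops_period[OF KK, of N] by (simp add: mult.commute)
    show "?i = i"
    proof (rule ccontr)
      assume ne: "?i \<noteq> i"
      have step: "long_hops ?i n = long_hops i (n + N) - long_hops i N" for n
        using long_hops_add[of i N n] by (simp add: add.commute)
      have not0: "long_hops i N - U \<noteq> 0"
        using never_meet[OF i i' ne[symmetric] lev, of 0] by auto
      show False
      proof (cases "0 < long_hops i N - U")
        case True
        \<comment> \<open>Since \<open>i\<close> and \<open>?i\<close> do not cross, each window of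
          \<open>N\<close> steps contains more than \<open>U\<close> long hops, so \<open>K\<close>
          consecutive windows exceed the total \<open>K * U\<close>. The other sign is
          symmetric.\<close>
        have gt: "U + 1 \<le> long_hops i (n + N) - long_hops i n" for n
          using stays_below[OF i i' ne[symmetric] True lev, of n] by (simp add: step)
        have "int k * (U + 1) \<le> long_hops i (k * N)" for k
        proof (induction k)
          case (Suc k)
          then show ?case using gt[of "k * N"] by (simp add: algebra_simps)
        qed simp
        from this[of K] show False using total K(2) by (simp add: algebra_simps)
      next
        case False
        then have neg: "long_hops i N - U < 0" using not0 by simp
        have gt: "long_hops i (n + N) - long_hops i n \<le> U - 1" for n
          using stays_above[OF i i' ne[symmetric] neg lev, of n] by (simp add: step)
        have "long_hops i (k * N) \<le> int k * (U - 1)" for k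
        proof (induction k)
          case (Suc k)
          then show ?case using gt[of "k * N"] by (simp add: algebra_simps)
        qed simp
        from this[of K] show False using total K(2) by (simp add: algebra_simps)
      qed
    qed
  qed
qed

end

section \<open>Signs of permutations with cycles of equal length\<close>

lemma sign_cycle_of_list:
  "distinct cs \<Longrightarrow> sign (cycle_of_list cs) = (- 1) ^ (length cs - 1)"
proof (induction cs rule: cycle_of_list.induct)
  case (1 i j cs)
  then show ?case
    using sign_compose[OF permutation_swap_id[of i j] permutation_of_cycle[of "j # cs"]]
    by (simp add: sign_swap_id o_def)
qed simp_all

text \<open>The points of \<open>S\<close> split into \<open>card S div L\<close> cycles of length
  \<open>L\<close>. The induction splits off the cycle through one point; the remaining permutation
  \<open>q\<close> keeps the return times outside it.\<close>

lemma sign_uniform_cycles: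
  assumes "finite S" "p permutes S" "\<And>i. i \<in> S \<Longrightarrow> least_power p i = L"
  shows "sign p = ((- 1) ^ (L - 1)) ^ (card S div L)"
  using assms
proof (induction S arbitrary: p rule: finite_psubset_induct)
  case (psubset S)
  have perm: "permutation p"
    using psubset by (auto simp: permutation_permutes)
  show ?case
  proof (cases "S = {}")
    case True
    then show ?thesis using psubset.prems(1) by simp
  next
    case False
    then obtain a where a: "a \<in> S" by blast
    define C where "C = set (support p a)"
    have La: "least_power p a = L" using psubset.prems(2) a .
    have L: "0 < L" using least_power_of_permutation(2)[OF perm, of a] La by simp
    have dist: "distinct (support p a)" using cycle_of_permutation[OF perm] .
    have cardC: "card C = L" unfolding C_def distinct_card[OF dist] using La by simp
    have CS: "C \<subseteq> S"
      using a permutes_in_image[OF permutes_funpow[OF psubset.prems(1)]] by (auto simp: C_def)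
    have "a \<in> C" unfolding C_def support_set[OF perm] by (rule range_eqI[of _ _ 0]) simp
    define q where "q = (\<lambda>y. if y \<in> S - C then p y else y)"
    have q: "q permutes (S - C)"
      unfolding q_def C_def by (rule semidecomposition) (use psubset in auto)
    have pow: "(q ^^ n) i \<in> S - C \<and> (q ^^ n) i = (p ^^ n) i" if "i \<in> S - C" for i n
    proof (induction n)
      case (Suc n)
      have "q ((q ^^ n) i) \<in> S - C" using conjunct1[OF Suc] by (simp only: permutes_in_image[OF q])
      moreover have "q ((q ^^ n) i) = p ((q ^^ n) i)" using conjunct1[OF Suc] by (simp only: q_def if_True)
      ultimately show ?case using Suc by (metis funpow.simps(2) o_apply)
    qed (use that in simp)
    have "least_power q i = L" if "i \<in> S - C" for i
      using psubset.prems(2)[of i] that pow[OF that] by (simp add: least_power_def)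
    then have sign_q: "sign q = ((- 1) ^ (L - 1)) ^ (card (S - C) div L)"
      using psubset.IH[of "S - C" q] q CS a \<open>a \<in> C\<close> by blast
    have "p = cycle_of_list (support p a) \<circ> q"
    proof
      fix y
      consider "y \<in> C" | "y \<in> S - C" | "y \<notin> S" using CS by blast
      then show "p y = (cycle_of_list (support p a) \<circ> q) y"
      proof cases
        case 1
        then show ?thesis using cycle_restrict[OF perm, of y a] by (simp add: q_def C_def)
      next
        case 2
        then have "q y \<in> S - C" by (simp only: permutes_in_image[OF q])
        then show ?thesis using 2 id_outside_supp[of "p y" "support p a"] by (simp add: q_def C_def)
      next
        case 3
        then have "y \<notin> C" using CS by blast
        then show ?thesis using 3 id_outside_supp[of y "support p a"] psubset.prems(1)
          by (simp add: q_def C_def permutes_not_in)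
      qed
    qed
    moreover have "permutation q" using q psubset.hyps by (auto simp: permutation_permutes)
    ultimately have "sign p = sign (cycle_of_list (support p a)) * sign q"
      using sign_compose[OF permutation_of_cycle] by metis
    also have "sign (cycle_of_list (support p a)) = (- 1) ^ (L - 1)"
      using sign_cycle_of_list[OF dist] La by simp
    also have "card S div L = Suc (card (S - C) div L)"
      using L cardC CS psubset.hyps card_mono[OF psubset.hyps CS]
      by (simp add: card_Diff_subset finite_subset le_div_geq)
    then have "(- 1) ^ (L - 1) * sign q = ((- 1) ^ (L - 1)) ^ (card S div L)"
      unfolding sign_q by simp
    finally show ?thesis .
  qed
qed

text \<open>By \<open>return_iff\<close>, this is the common cycle length of the moved points when
  \<open>n\<close> points move and \<open>c\<close> of them move by \<open>b\<close>. The conjuncts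
  follow the order in \<open>least_power\<close>.\<close>

definition return_time :: "nat \<Rightarrow> nat \<Rightarrow> nat \<Rightarrow> nat \<Rightarrow> nat \<Rightarrow> nat" where
  "return_time d a b n c = (LEAST N. (\<exists>U. int n * U = int N * int c \<and>
     int d dvd int a * int N + (int b - int a) * U) \<and> N > 0)"

context hopping_permutation
begin

text \<open>This is what excludes cancellation: the sign is a function of two counts of
  \<open>p\<close> alone, because all nontrivial cycles have the length \<open>L\<close>.\<close>

lemma sign_eq:
  fixes L
  defines "L \<equiv> return_time d a b (card moved) (card {i. i < d \<and> p i = (i + b) mod d})"
  shows "sign p = ((- 1) ^ (L - 1)) ^ (card moved div L)"
proof (rule sign_uniform_cycles)
  show "p permutes moved"
    by (rule permutes_superset[OF perm]) (auto simp: moved_def)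
  show "least_power p i = L" if "i \<in> moved" for i
    unfolding least_power_def L_def return_time_def return_iff[OF that] ..
qed simp

end

section \<open>Existence of hopping permutations with prescribed step counts\<close>

context circulant_steps
begin

lemma sum_shift: "(\<Sum>i\<in>{0..<d}. f ((i + c) mod d)) = (\<Sum>i\<in>{0..<d}. f i)"
proof -
  have inj: "inj_on (\<lambda>i. (i + c) mod d) {0..<d}"
  proof (rule inj_onI)
    fix i j assume ij: "i \<in> {0..<d}" "j \<in> {0..<d}" and "(i + c) mod d = (j + c) mod d"
    then have "[i = j] (mod d)" using cong_add_rcancel_nat cong_def by blast
    then show "i = j" using ij cong_less_modulus_unique_nat by auto
  qed
  have sub: "(\<lambda>i. (i + c) mod d) ` {0..<d} \<subseteq> {0..<d}" using b_less_d by auto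
  have "bij_betw (\<lambda>i. (i + c) mod d) {0..<d} {0..<d}"
    unfolding bij_betw_def using endo_inj_surj[OF _ sub inj] inj by simp
  then show ?thesis by (rule sum.reindex_bij_betw)
qed

text \<open>
  Summing \<open>(r + s) mod d = r + s - d * [r \<ge> d - s]\<close> over an arithmetic progression of
  residues, which is invariant under the shift, leaves only the number of wrap-arounds.
\<close>

lemma card_wrap:
  assumes "[t * int c = s] (mod int d)" "0 \<le> s" "s \<le> int d"
  shows "int (card {i. i < d \<and> int d - s \<le> (t * int i) mod int d}) = s"
proof -
  define r where "r i = (t * int i) mod int d" for i
  have d0: "0 < int d" using b_less_d by simp
  have r_range: "0 \<le> r i" "r i < int d" for i using d0 by (auto simp: r_def)
  have shift: "r ((i + c) mod d) = r i + s - int d * (if int d - s \<le> r i then 1 else 0)" for i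
  proof -
    have "[t * int ((i + c) mod d) = t * int i + t * int c] (mod int d)"
      by (simp add: cong_def zmod_int mod_mult_right_eq distrib_left)
    also have "[t * int i + t * int c = r i + s] (mod int d)"
      by (intro cong_add assms) (simp add: r_def cong_def)
    finally have "r ((i + c) mod d) = (r i + s) mod int d" by (simp add: r_def cong_def)
    also have "\<dots> = r i + s - int d * (if int d - s \<le> r i then 1 else 0)"
    proof (cases "int d - s \<le> r i")
      case True
      have "(r i + s) mod int d = (r i + s - int d) mod int d" by simp
      also have "\<dots> = r i + s - int d"
        using True r_range[of i] assms(3) by (intro mod_pos_pos_trivial) auto
      finally show ?thesis using True by simp
    next
      case False
      then show ?thesis using r_range[of i] assms(2) by (simp add: mod_pos_pos_trivial)
    qed
    finally show ?thesis .
  qed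
  have "(\<Sum>i\<in>{0..<d}. r i) = (\<Sum>i\<in>{0..<d}. r ((i + c) mod d))"
    by (rule sum_shift[symmetric])
  also have "\<dots> = (\<Sum>i\<in>{0..<d}. r i) + int d * s - int d * (\<Sum>i\<in>{0..<d}. if int d - s \<le> r i then 1 else 0)"
    unfolding shift by (simp add: sum_subtractf sum.distrib sum_distrib_left)
  also have "(\<Sum>i\<in>{0..<d}. if int d - s \<le> r i then 1 else (0::int)) = int (card ({0..<d} \<inter> {i. int d - s \<le> r i}))"
    by (simp add: sum.If_cases)
  also have "{0..<d} \<inter> {i. int d - s \<le> r i} = {i. i < d \<and> int d - s \<le> r i}" by auto
  finally have "int d * s = int d * int (card {i. i < d \<and> int d - s \<le> r i})" by simp
  then show ?thesis using d0 by (simp add: r_def)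
qed

text \<open>With \<open>a * u + b * v \<equiv> 1\<close> the witness \<open>u * z - v * y\<close>
  works, since \<open>a * y \<equiv> - b * z\<close>. Multiplication by \<open>t\<close> turns the
  steps \<open>a\<close> and \<open>b\<close> into \<open>z\<close> and \<open>- y\<close>.\<close>

lemma ex_slope:
  assumes "d dvd a * y + b * z"
  shows "\<exists>t. [t * int a = int z] (mod int d) \<and> [t * int b = - int y] (mod int d)"
proof -
  obtain u v where uv: "[1 = int a * u + int b * v] (mod int d)" using bezout_level by blast
  then have uv': "int d dvd 1 - (int a * u + int b * v)" by (simp add: cong_iff_dvd_diff)
  have dvd': "int d dvd int a * int y + int b * int z"
    using assms by (metis of_nat_add of_nat_dvd_iff of_nat_mult)
  define t where "t = u * int z - v * int y"
  have "t * int a - int z = - (v * (int a * int y + int b * int z)) - int z * (1 - (int a * u + int b * v))"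
    by (simp add: t_def algebra_simps)
  then have ta: "[t * int a = int z] (mod int d)"
    unfolding cong_iff_dvd_diff using dvd' uv' by (simp only: dvd_diff dvd_minus_iff dvd_mult)
  have "t * int b - (- int y) = u * (int a * int y + int b * int z) + int y * (1 - (int a * u + int b * v))"
    by (simp add: t_def algebra_simps)
  then have tb: "[t * int b = - int y] (mod int d)"
    unfolding cong_iff_dvd_diff using dvd' uv' by (simp only: dvd_add dvd_mult)
  from ta tb show ?thesis by blast
qed

text \<open>
  The permutation is a three-interval exchange of the residues \<open>r i = t * i mod d\<close>: the
  intervals of lengths \<open>x\<close>, \<open>y\<close>, \<open>z\<close> are moved by \<open>0\<close>, \<open>z \<equiv> t * a\<close>, \<open>- y \<equiv> t * b\<close>.
\<close>

lemma ex_hopping_permutation: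
  assumes sum: "x + y + z = d" and dvd: "d dvd a * y + b * z"
  shows "\<exists>p. hopping_permutation d a b p \<and>
    card {i. i < d \<and> p i = i} = x \<and> card {i. i < d \<and> p i = (i + a) mod d} = y \<and>
    card {i. i < d \<and> p i = (i + b) mod d} = z"
proof -
  obtain t where ta: "[t * int a = int z] (mod int d)" and tb: "[t * int b = - int y] (mod int d)"
    using ex_slope[OF dvd] by blast
  define r where "r i = (t * int i) mod int d" for i
  have d0: "0 < int d" using b_less_d by simp
  have r_range: "0 \<le> r i" "r i < int d" for i using d0 by (auto simp: r_def)
  define p where "p i = (if d \<le> i then i else if r i < int x then i
    else if r i < int x + int y then (i + a) mod d else (i + b) mod d)" for i
  have r_shift: "r ((i + c) mod d) = (r i + w) mod int d" if "[t * int c = w] (mod int d)" for i c w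
  proof -
    have "[t * int ((i + c) mod d) = t * int i + t * int c] (mod int d)"
      by (simp add: cong_def zmod_int mod_mult_right_eq distrib_left)
    also have "[t * int i + t * int c = r i + w] (mod int d)"
      by (intro cong_add that) (simp add: r_def cong_def)
    finally show ?thesis by (simp add: r_def cong_def)
  qed
  \<comment> \<open>The interval \<open>[x, x + y)\<close> goes to \<open>[x + z, d)\<close> and
    \<open>[x + y, d)\<close> goes to \<open>[x, x + z)\<close>, in both cases without wrapping
    around.\<close>
  have image_a: "r ((i + a) mod d) = r i + int z" if "r i < int x + int y" for i
    unfolding r_shift[OF ta] using that r_range[of i] sum by (intro mod_pos_pos_trivial) auto
  have image_b: "r ((i + b) mod d) = r i - int y" if "\<not> r i < int x + int y" for i
    unfolding r_shift[OF tb] using that r_range[of i] sum by (subst mod_pos_pos_trivial) auto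
  have inj: "inj_on p {0..<d}"
  proof (rule inj_onI)
    fix i j assume i: "i \<in> {0..<d}" and j: "j \<in> {0..<d}" and eq: "p i = p j"
    have inj_shift: "i = j" if "(i + c) mod d = (j + c) mod d" for c
    proof -
      have "[i = j] (mod d)" using that cong_add_rcancel_nat cong_def by blast
      then show ?thesis using i j cong_less_modulus_unique_nat by auto
    qed
    \<comment> \<open>As \<open>r\<close> need not be injective, injectivity of \<open>p\<close>
      takes two steps: the interval of the image reveals which rule was applied, and each single
      rule is injective.\<close>
    have img: "(r k < int x \<longleftrightarrow> r (p k) < int x) \<and>
         (r k < int x + int y \<and> \<not> r k < int x \<longleftrightarrow> int x + int z \<le> r (p k))" if "k \<in> {0..<d}" for k
      using that r_range[of k] image_a[of k] image_b[of k] sum by (auto simp: p_def)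
    have "(r i < int x \<longleftrightarrow> r j < int x) \<and> (r i < int x + int y \<longleftrightarrow> r j < int x + int y)"
      using img[OF i] img[OF j] eq by auto
    then show "i = j"
      using eq i j inj_shift[of a] inj_shift[of b] by (auto simp: p_def split: if_splits)
  qed
  have sub: "p ` {0..<d} \<subseteq> {0..<d}" using b_less_d by (auto simp: p_def)
  have "bij_betw p {0..<d} {0..<d}"
    unfolding bij_betw_def using endo_inj_surj[OF _ sub inj] inj by simp
  then have perm: "p permutes {0..<d}" by (rule bij_imp_permutes) (auto simp: p_def)
  have hop: "hopping_permutation d a b p"
    by unfold_locales (use perm in \<open>auto simp: p_def\<close>)
  have kind: "(p i = i \<longleftrightarrow> r i < int x) \<and>
      (p i = (i + a) mod d \<longleftrightarrow> int x \<le> r i \<and> r i < int x + int y) \<and>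
      (p i = (i + b) mod d \<longleftrightarrow> int d - int z \<le> r i)" if "i < d" for i
    using that add_mod_neq[of i] add_mod_neq[of i, symmetric] sum by (auto simp: p_def)
  have X: "{i. i < d \<and> p i = i} = {i. i < d \<and> r i < int x}"
    using kind by blast
  have Y: "{i. i < d \<and> p i = (i + a) mod d} = {i. i < d \<and> int x \<le> r i \<and> r i < int x + int y}"
    using kind by blast
  have Z: "{i. i < d \<and> p i = (i + b) mod d} = {i. i < d \<and> int d - int z \<le> r i}"
    using kind by blast
  have cardZ: "card {i. i < d \<and> p i = (i + b) mod d} = z"
    using card_wrap[OF ta] sum unfolding Z r_def by simp
  have "[t * int b - t * int a = - int y - int z] (mod int d)" by (intro cong_diff ta tb)
  then have "[t * int (b - a) = - int y - int z + int d] (mod int d)"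
    using a_less_b by (simp add: of_nat_diff right_diff_distrib cong_def)
  \<comment> \<open>The step \<open>d - (b - a)\<close>, which is \<open>a - b\<close> modulo
    \<open>d\<close>, is turned by \<open>t\<close> into \<open>y + z\<close>; so
    \<open>card_wrap\<close> counts the two moving intervals together.\<close>
  then have tx: "[t * int (d - (b - a)) = int y + int z] (mod int d)"
  proof -
    have "t * int (d - (b - a)) - (int y + int z) =
        t * int d - int d - (t * int (b - a) - (- int y - int z + int d))"
      using a_less_b b_less_d by (simp add: of_nat_diff algebra_simps)
    then show ?thesis
      using \<open>[t * int (b - a) = _] (mod int d)\<close> unfolding cong_iff_dvd_diff
      by (simp only: dvd_diff dvd_triv_right dvd_refl)
  qed
  have "card {i. i < d \<and> int x \<le> r i} = y + z"
  proof -
    have x: "int d - (int y + int z) = int x" using sum by simp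
    show ?thesis using card_wrap[OF tx] sum unfolding r_def x by simp
  qed
  moreover have "{i. i < d \<and> int x \<le> r i} = {i. i < d \<and> int x \<le> r i \<and> r i < int x + int y} \<union> {i. i < d \<and> int d - int z \<le> r i}"
    using sum by auto
  moreover have "{i. i < d \<and> int x \<le> r i \<and> r i < int x + int y} \<inter> {i. i < d \<and> int d - int z \<le> r i} = {}"
    using sum by auto
  ultimately have "card {i. i < d \<and> int x \<le> r i \<and> r i < int x + int y} + z = y + z"
    using cardZ card_Un_disjoint[of "{i. i < d \<and> int x \<le> r i \<and> r i < int x + int y}"
      "{i. i < d \<and> int d - int z \<le> r i}"] unfolding Z by simp
  then have cardY: "card {i. i < d \<and> p i = (i + a) mod d} = y" unfolding Y by simp
  have "{0..<d} = {i. i < d \<and> r i < int x} \<union> {i. i < d \<and> int x \<le> r i}" by auto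
  then have "d = card ({i. i < d \<and> r i < int x} \<union> {i. i < d \<and> int x \<le> r i})"
    by (metis card_atLeastLessThan diff_zero)
  also have "\<dots> = card {i. i < d \<and> r i < int x} + card {i. i < d \<and> int x \<le> r i}"
    by (rule card_Un_disjoint) auto
  finally have "card {i. i < d \<and> p i = i} = x"
    unfolding X using \<open>card {i. i < d \<and> int x \<le> r i} = y + z\<close> sum by simp
  with hop cardY cardZ show ?thesis by blast
qed

end

subsection \<open>The norm of a linear form as a circulant determinant\<close>

lemma primitive_root_power_eq_1_iff:
  fixes e :: "'k :: field"
  assumes "primitive_root_of_unity d e"
  shows "e ^ n = 1 \<longleftrightarrow> d dvd n"
proof -
  have d: "0 < d" "e ^ d = 1" "\<And>k. 0 < k \<Longrightarrow> k < d \<Longrightarrow> e ^ k \<noteq> 1"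
    using assms by (auto simp: primitive_root_of_unity_def)
  have "e ^ n = e ^ (d * (n div d) + n mod d)" by simp
  also have "\<dots> = e ^ (n mod d)" unfolding power_add power_mult by (simp add: d(2))
  finally have "e ^ n = e ^ (n mod d)" .
  then show ?thesis
    using d(3)[of "n mod d"] d(1) by (cases "n mod d = 0") (auto simp: dvd_eq_mod_eq_0)
qed

lemma primitive_root_nonzero:
  "primitive_root_of_unity d e \<Longrightarrow> e \<noteq> (0 :: 'k :: field)"
  by (auto simp: primitive_root_of_unity_def zero_power)

lemma primitive_root_power_cong:
  fixes e :: "'k :: field"
  assumes "primitive_root_of_unity d e" "[m = n] (mod d)"
  shows "e ^ m = e ^ n"
proof -
  have "e ^ k = e ^ (k mod d)" for k
  proof -
    have "e ^ k = e ^ (d * (k div d) + k mod d)" by simp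
    also have "\<dots> = e ^ (k mod d)"
      unfolding power_add power_mult using assms(1) by (simp add: primitive_root_of_unity_def)
    finally show ?thesis .
  qed
  then show ?thesis using assms(2) unfolding cong_def by metis
qed

lemma primitive_root_power_eq_iff:
  fixes e :: "'k :: field"
  assumes "primitive_root_of_unity d e"
  shows "e ^ m = e ^ n \<longleftrightarrow> [m = n] (mod d)"
proof
  have e0: "e \<noteq> 0" using primitive_root_nonzero[OF assms] .
  have *: "[m = n] (mod d)" if "e ^ m = e ^ n" "m \<le> n" for m n
  proof -
    have "e ^ (n - m) = 1" using that e0 by (simp add: power_diff)
    then have "d dvd n - m" using primitive_root_power_eq_1_iff[OF assms] by simp
    then show ?thesis using that(2) by (metis cong_altdef_nat cong_sym)
  qed
  show "[m = n] (mod d)" if "e ^ m = e ^ n"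
    using *[of m n] *[of n m] that by (metis cong_sym nat_le_linear)
  show "e ^ m = e ^ n" if "[m = n] (mod d)"
    using primitive_root_power_cong[OF assms that] .
qed

text \<open>Orthogonality of the characters of a cyclic group, as a geometric sum with ratio
  \<open>w\<close>.\<close>

lemma sum_root_powers:
  fixes e :: "'k :: field"
  assumes e: "primitive_root_of_unity d e" and "i < d" "k < d"
  shows "(\<Sum>j\<in>{0..<d}. e ^ (i * j) * inverse e ^ (j * k)) = (if i = k then of_nat d else 0)"
proof -
  have e0: "e \<noteq> 0" using primitive_root_nonzero[OF e] .
  define w where "w = e ^ i * inverse e ^ k"
  have w: "e ^ (i * j) * inverse e ^ (j * k) = w ^ j" for j
    by (simp add: w_def power_mult_distrib mult.commute flip: power_mult)
  show ?thesis
  proof (cases "i = k")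
    case True
    then have "w = 1" using e0 by (simp add: w_def flip: power_mult_distrib)
    then show ?thesis using True unfolding w by simp
  next
    case False
    have "w \<noteq> 1"
    proof
      assume "w = 1"
      then have "e ^ i = e ^ k" using e0 by (simp add: w_def field_simps)
      then have "[i = k] (mod d)" using primitive_root_power_eq_iff[OF e] by simp
      then show False using False assms(2,3) cong_less_modulus_unique_nat by blast
    qed
    moreover have "w ^ d = 1"
    proof -
      have "w ^ d = (e ^ d) ^ i * inverse (e ^ d) ^ k"
        by (simp add: w_def power_mult_distrib mult.commute power_inverse flip: power_mult)
      then show ?thesis using e by (simp add: primitive_root_of_unity_def)
    qed
    moreover have "(1 - w) * (\<Sum>j<d. w ^ j) = 1 - w ^ d" by (rule one_diff_power_eq[symmetric])
    ultimately have "(\<Sum>j<d. w ^ j) = 0" by simp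
    then show ?thesis using False unfolding w by (simp add: atLeast0LessThan)
  qed
qed

lemma prod_monom: "finite A \<Longrightarrow> (\<Prod>i\<in>A. monom (c i) (n i)) = monom (\<Prod>i\<in>A. c i) (\<Sum>i\<in>A. n i)"
  by (induction A rule: finite_induct) (simp_all add: mult_monom)

section \<open>The circulant determinant and its Leibniz expansion\<close>

context circulant_steps
begin

text \<open>The entries are \<open>X\<close>, \<open>Y\<close> and \<open>1\<close>, the last standing for the third variable.\<close>

definition circulant :: "'k :: field_char_0 poly poly mat" where
  "circulant = mat d d (\<lambda>(i, k). if k = i then [:0, 1:] else if k = (i + a) mod d then [:[:0, 1:]:]
     else if k = (i + b) mod d then 1 else 0)"

text \<open>The Fourier matrix \<open>F\<close> diagonalises the circulant: its columns are
  characters, on which the shifts by \<open>a\<close> and \<open>b\<close> act as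
  \<open>e ^ (a * j)\<close> and \<open>e ^ (b * j)\<close>. Its determinant can be cancelled
  because \<open>F * G\<close> is \<open>d\<close> times the identity and \<open>d\<close> is
  nonzero in characteristic zero.\<close>

lemma det_circulant:
  fixes e :: "'k :: field_char_0"
  assumes e: "primitive_root_of_unity d e"
  shows "det circulant = (\<Prod>j\<in>{0..<d}. [:[:e ^ (b * j), e ^ (a * j):], 1:])"
proof -
  define F where "F = mat d d (\<lambda>(k, j). [:[:e ^ (k * j):]:])"
  define G where "G = mat d d (\<lambda>(j, k). [:[:inverse e ^ (j * k):]:])"
  define D where "D = mat d d (\<lambda>(i, j). if i = j then [:[:e ^ (b * j), e ^ (a * j):], 1:] else 0)"
  have carr: "circulant \<in> carrier_mat d d" "F \<in> carrier_mat d d" "G \<in> carrier_mat d d" "D \<in> carrier_mat d d"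
    by (simp_all add: circulant_def F_def G_def D_def)
  have "F * G = [:[:of_nat d:]:] \<cdot>\<^sub>m 1\<^sub>m d"
  proof (rule eq_matI)
    fix i k assume "i < dim_row ([:[:of_nat d:]:] \<cdot>\<^sub>m 1\<^sub>m d :: 'k poly poly mat)"
      "k < dim_col ([:[:of_nat d:]:] \<cdot>\<^sub>m 1\<^sub>m d :: 'k poly poly mat)"
    then have ik: "i < d" "k < d" by auto
    have "(F * G) $$ (i, k) = (\<Sum>j\<in>{0..<d}. [:[:e ^ (i * j) * inverse e ^ (j * k):]:])"
      using ik by (simp add: F_def G_def scalar_prod_def)
    also have "\<dots> = [:[:\<Sum>j\<in>{0..<d}. e ^ (i * j) * inverse e ^ (j * k):]:]"
      by (induction d) simp_all
    finally show "(F * G) $$ (i, k) = ([:[:of_nat d:]:] \<cdot>\<^sub>m 1\<^sub>m d) $$ (i, k)"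
      using ik by (simp add: sum_root_powers[OF e])
  qed (simp_all add: F_def G_def)
  then have "det F * det G = [:[:of_nat d:]:] ^ d"
    using det_mult[OF carr(2,3)] by simp
  then have detF: "det F \<noteq> 0"
    using b_less_d by (metis mult_zero_left not_less0 of_nat_eq_0_iff pCons_eq_0_iff power_not_zero)
  have "circulant * F = F * D"
  proof (rule eq_matI)
    fix i j assume "i < dim_row (F * D)" "j < dim_col (F * D)"
    then have ij: "i < d" "j < d" by (auto simp: F_def D_def)
    have red: "e ^ ((i + c) mod d * j) = e ^ (i * j) * e ^ (c * j)" for c
    proof -
      have "e ^ ((i + c) mod d * j) = e ^ ((i + c) * j)"
        by (rule primitive_root_power_cong[OF e]) (simp add: cong_def mod_mult_left_eq)
      then show ?thesis by (simp add: distrib_right power_add)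
    qed
    have "(circulant * F) $$ (i, j) = (\<Sum>k\<in>{0..<d}. (if k = i then [:0, 1:] else if k = (i + a) mod d then [:[:0, 1:]:]
       else if k = (i + b) mod d then 1 else 0) * [:[:e ^ (k * j):]:])"
      using ij by (simp add: circulant_def F_def scalar_prod_def)
    also have "\<dots> = (\<Sum>k\<in>{i, (i + a) mod d, (i + b) mod d}. (if k = i then [:0, 1:] else if k = (i + a) mod d then [:[:0, 1:]:]
       else if k = (i + b) mod d then 1 else 0) * [:[:e ^ (k * j):]:])"
      by (rule sum.mono_neutral_right) (use ij in auto)
    also have "\<dots> = [:[:e ^ (i * j):]:] * [:[:e ^ (b * j), e ^ (a * j):], 1:]"
      using add_mod_neq[of i] add_mod_neq[of i, symmetric] ij by (simp add: red)
    also have "\<dots> = (\<Sum>k\<in>{0..<d}. if k = j then F $$ (i, k) * D $$ (k, j) else 0)"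
      using ij by (simp add: F_def D_def)
    also have "\<dots> = (\<Sum>k\<in>{0..<d}. F $$ (i, k) * D $$ (k, j))"
      by (rule sum.cong) (use ij in \<open>auto simp: D_def\<close>)
    also have "\<dots> = (F * D) $$ (i, j)"
      using ij by (simp add: F_def D_def scalar_prod_def)
    finally show "(circulant * F) $$ (i, j) = (F * D) $$ (i, j)" .
  qed (simp_all add: circulant_def F_def D_def)
  then have "det circulant * det F = det D * det F"
    using det_mult[OF carr(1,2)] det_mult[OF carr(2,4)] by (simp only: mult.commute)
  then have "det circulant = det D" by (rule mult_right_cancel[THEN iffD1, OF detF])
  also have "\<dots> = prod_list (diag_mat D)"
    by (rule det_upper_triangular[OF _ carr(4)]) (auto simp: upper_triangular_def D_def)
  also have "\<dots> = (\<Prod>j\<in>{0..<d}. [:[:e ^ (b * j), e ^ (a * j):], 1:])"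
    unfolding prod_list_diag_prod by (rule prod.cong) (auto simp: D_def)
  finally show ?thesis .
qed

text \<open>The steps 0, \<open>a\<close> and \<open>b\<close> are distinct modulo \<open>d\<close>,
  so each nonzero factor is exactly one of X, Y and 1, and the product records the step
  counts.\<close>

lemma prod_circulant:
  assumes "p permutes {0..<d}"
  shows "(\<Prod>i\<in>{0..<d}. (circulant :: 'k :: field_char_0 poly poly mat) $$ (i, p i)) =
    (if hopping_permutation d a b p
     then monom (monom 1 (card {i. i < d \<and> p i = (i + a) mod d})) (card {i. i < d \<and> p i = i}) else 0)"
proof (cases "hopping_permutation d a b p")
  case True
  have range: "p i < d" if "i < d" for i using permutes_in_image[OF assms, of i] that by simp
  have "(circulant :: 'k poly poly mat) $$ (i, p i) = monom (monom 1 (if p i = (i + a) mod d then 1 else 0)) (if p i = i then 1 else 0)"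
    if "i < d" for i
    using hopping_permutation.hop[OF True that] add_mod_neq[of i] that range[OF that]
    by (auto simp: circulant_def monom_Suc monom_0 one_pCons)
  then have "(\<Prod>i\<in>{0..<d}. (circulant :: 'k poly poly mat) $$ (i, p i)) =
      (\<Prod>i\<in>{0..<d}. monom (monom (1::'k) (if p i = (i + a) mod d then 1 else 0)) (if p i = i then 1 else 0))"
    by (intro prod.cong) auto
  also have "\<dots> = monom (monom 1 (\<Sum>i\<in>{0..<d}. if p i = (i + a) mod d then 1 else 0)) (\<Sum>i\<in>{0..<d}. if p i = i then 1 else 0)"
    by (simp add: prod_monom)
  also have "(\<Sum>i\<in>{0..<d}. if p i = (i + a) mod d then 1 else 0) = card {i. i < d \<and> p i = (i + a) mod d}"
    by (simp add: sum.If_cases Int_def)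
  also have "(\<Sum>i\<in>{0..<d}. if p i = i then 1 else 0) = card {i. i < d \<and> p i = i}"
    by (simp add: sum.If_cases Int_def)
  finally show ?thesis using True by simp
next
  case False
  then obtain i where i: "i < d" "p i \<noteq> i" "p i \<noteq> (i + a) mod d" "p i \<noteq> (i + b) mod d"
    using assms circulant_steps_axioms by (auto simp: hopping_permutation_def hopping_permutation_axioms_def)
  have "p i < d" using permutes_in_image[OF assms, of i] i by simp
  with i have "(circulant :: 'k poly poly mat) $$ (i, p i) = 0" by (simp add: circulant_def)
  then have "(\<Prod>i\<in>{0..<d}. (circulant :: 'k poly poly mat) $$ (i, p i)) = 0"
    using i(1) by (auto simp: prod_zero_iff)
  then show ?thesis using False by simp
qed

text \<open>The coefficient is the signed count of the hopping permutations with step counts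
  \<open>x\<close>, \<open>y\<close>, \<open>z\<close>. By \<open>sign_eq\<close> they all have the
  same sign and by \<open>ex_hopping_permutation\<close> there is at least one, so the sum is
  nonzero in characteristic zero.\<close>

theorem coeff_prod_linear_forms_nonzero:
  fixes e :: "'k :: field_char_0"
  assumes e: "primitive_root_of_unity d e"
    and sum: "x + y + z = d" and dvd: "d dvd a * y + b * z"
  shows "coeff (coeff (\<Prod>j\<in>{0..<d}. [:[:e ^ (b * j), e ^ (a * j):], 1:]) x) y \<noteq> 0"
proof -
  define Perms where "Perms = {p. hopping_permutation d a b p \<and>
    card {i. i < d \<and> p i = i} = x \<and> card {i. i < d \<and> p i = (i + a) mod d} = y}"
  have sub: "Perms \<subseteq> {p. p permutes {0..<d}}"
    by (auto simp: Perms_def dest: hopping_permutation.perm)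
  then have fin: "finite Perms" using finite_permutations[of "{0..<d}"] by (rule finite_subset) simp
  define L where "L = return_time d a b (d - x) z"
  have sign: "sign p = ((- 1) ^ (L - 1)) ^ ((d - x) div L)" if "p \<in> Perms" for p
  proof -
    interpret hopping_permutation d a b p using that by (simp add: Perms_def)
    have "{0..<d} = {i. i < d \<and> p i = i} \<union> moved" by (auto simp: moved_def)
    then have "d = card ({i. i < d \<and> p i = i} \<union> moved)" by (metis card_atLeastLessThan diff_zero)
    also have "\<dots> = x + card moved"
      using that by (subst card_Un_disjoint) (auto simp: moved_def Perms_def)
    finally have m: "card moved = d - x" by simp
    \<comment> \<open>\<open>Perms\<close> prescribes two of the counts; the number of points moved
      by \<open>b\<close> is what remains of the moved points.\<close>
    have "moved = {i. i < d \<and> p i = (i + a) mod d} \<union> {i. i < d \<and> p i = (i + b) mod d}"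
      using hop add_mod_neq by (fastforce simp: moved_def)
    moreover have "{i. i < d \<and> p i = (i + a) mod d} \<inter> {i. i < d \<and> p i = (i + b) mod d} = {}"
    proof -
      have "\<not> (p i = (i + a) mod d \<and> p i = (i + b) mod d)" for i
        using add_mod_neq(3)[of i] by argo
      then show ?thesis by blast
    qed
    ultimately have "card moved = y + card {i. i < d \<and> p i = (i + b) mod d}"
      using that by (simp add: card_Un_disjoint Perms_def)
    then have z: "card {i. i < d \<and> p i = (i + b) mod d} = z" using m sum by simp
    show ?thesis using sign_eq unfolding m z L_def .
  qed
  have ne: "Perms \<noteq> {}"
    using ex_hopping_permutation[OF sum dvd] by (auto simp: Perms_def)
  have "(\<Prod>j\<in>{0..<d}. [:[:e ^ (b * j), e ^ (a * j):], 1:]) =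
      (\<Sum>p | p permutes {0..<d}. of_int (sign p) * (\<Prod>i\<in>{0..<d}. circulant $$ (i, p i)))"
    unfolding det_circulant[OF e, symmetric] by (rule det_def') (simp add: circulant_def)
  also have "coeff (coeff \<dots> x) y = (\<Sum>p | p permutes {0..<d}. if p \<in> Perms then of_int (sign p) else 0)"
    unfolding coeff_sum
  proof (rule sum.cong[OF refl])
    fix p assume p: "p \<in> {p. p permutes {0..<d}}"
    show "coeff (coeff (of_int (sign p) * (\<Prod>i = 0..<d. circulant $$ (i, p i))) x) y =
        (if p \<in> Perms then of_int (sign p) else (0::'k))"
      using p by (auto simp: prod_circulant Perms_def of_int_poly)
  qed
  also have "\<dots> = (\<Sum>p\<in>Perms. of_int (sign p))"
    using sub finite_permutations[of "{0..<d}"] by (simp add: sum.If_cases Int_absorb1)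
  also have "\<dots> = of_nat (card Perms) * of_int (((- 1) ^ (L - 1)) ^ ((d - x) div L))"
    by (simp add: sign)
  also have "\<dots> \<noteq> 0" using fin ne by simp
  finally show ?thesis .
qed

text \<open>Faithfulness of the action: equal roots make \<open>d\<close> divide
  \<open>a * (i - j)\<close> and \<open>b * (i - j)\<close>, hence \<open>i - j\<close> by the gcd
  condition.\<close>

lemma linear_form_roots_inj:
  fixes e :: "'k :: field"
  assumes e: "primitive_root_of_unity d e"
  shows "inj_on (\<lambda>j. - [:e ^ (b * j), e ^ (a * j):]) {0..<d}"
proof (rule inj_onI)
  fix i j assume i: "i \<in> {0..<d}" and j: "j \<in> {0..<d}"
    and "- [:e ^ (b * i), e ^ (a * i):] = - [:e ^ (b * j), e ^ (a * j):]"
  then have "[a * i = a * j] (mod d)" "[b * i = b * j] (mod d)"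
    by (simp_all add: primitive_root_power_eq_iff[OF e])
  then have ab: "int d dvd int a * (int i - int j)" "int d dvd int b * (int i - int j)"
    by (simp_all add: cong_iff_dvd_diff right_diff_distrib flip: cong_int_iff)
  obtain u v where uv: "[1 = int a * u + int b * v] (mod int d)" using bezout_level by blast
  have "int i - int j = (1 - (int a * u + int b * v)) * (int i - int j)
      + u * (int a * (int i - int j)) + v * (int b * (int i - int j))"
    by (simp add: algebra_simps)
  then have "int d dvd int i - int j"
    using uv ab unfolding cong_iff_dvd_diff by (metis dvd_add dvd_mult dvd_mult2)
  then have "[int i = int j] (mod int d)" by (simp add: cong_iff_dvd_diff)
  then show "i = j" using i j by (simp add: cong_int_iff cong_less_modulus_unique_nat)
qed

text \<open>The difference \<open>D\<close> of the two sides has degree below \<open>d\<close>, as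
  its coefficient of degree \<open>d\<close> cancels, but has \<open>d\<close> distinct roots in the
  domain of inner polynomials.\<close>

lemma eq_smult_prod_linear_forms:
  fixes e :: "'k :: field" and Q :: "'k poly poly"
  assumes e: "primitive_root_of_unity d e" and deg: "degree Q \<le> d"
    and roots: "\<And>j. j < d \<Longrightarrow> poly Q (- [:e ^ (b * j), e ^ (a * j):]) = 0"
  shows "Q = Polynomial.smult (coeff Q d) (\<Prod>j\<in>{0..<d}. [:[:e ^ (b * j), e ^ (a * j):], 1:])"
proof -
  let ?P = "\<Prod>j\<in>{0..<d}. [:[:e ^ (b * j), e ^ (a * j):], 1:]"
  have degP: "degree ?P = d" by (subst degree_prod_eq_sum_degree) auto
  have "lead_coeff ?P = 1" by (simp add: lead_coeff_prod)
  then have coeffP: "coeff ?P d = 1" using degP by simp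
  define D where "D = Q - Polynomial.smult (coeff Q d) ?P"
  have "coeff D d = 0" by (simp add: D_def coeffP)
  have "D = 0"
  proof (rule ccontr)
    assume D: "D \<noteq> 0"
    have "degree D \<le> d" unfolding D_def
      by (rule degree_diff_le[OF deg]) (use degree_smult_le[of "coeff Q d" ?P] degP in simp)
    moreover have "degree D \<noteq> d" using D \<open>coeff D d = 0\<close> by (metis leading_coeff_0_iff)
    ultimately have lt: "degree D < d" by simp
    have "poly ?P (- [:e ^ (b * j), e ^ (a * j):]) = 0" if "j < d" for j
      unfolding poly_prod by (rule prod_zero) (use that in \<open>auto intro!: bexI[of _ j]\<close>)
    then have "(\<lambda>j. - [:e ^ (b * j), e ^ (a * j):]) ` {0..<d} \<subseteq> {x. poly D x = 0}"
      using roots by (auto simp: D_def simp del: minus_pCons)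
    then have "card ((\<lambda>j. - [:e ^ (b * j), e ^ (a * j):]) ` {0..<d}) \<le> card {x. poly D x = 0}"
      by (rule card_mono[OF poly_roots_finite[OF D]])
    also have "\<dots> \<le> degree D" by (rule card_poly_roots_bound[OF D])
    finally show False using lt card_image[OF linear_form_roots_inj[OF e]] by simp
  qed
  then show ?thesis by (simp add: D_def)
qed

end

subsection \<open>Polynomials in three variables\<close>

abbreviation (input) expo :: "monom3 \<Rightarrow> var \<Rightarrow> nat" where "expo \<equiv> Poly_Mapping.lookup"

abbreviation (input) mon :: "monom3 \<Rightarrow> 'k::field poly3" where "mon m \<equiv> Poly_Mapping.single m 1"

definition mk3 :: "nat \<Rightarrow> nat \<Rightarrow> nat \<Rightarrow> monom3" where
  "mk3 i j k = Poly_Mapping.single Vx i + Poly_Mapping.single Vy j + Poly_Mapping.single Vz k"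

lemma expo_mk3 [simp]: "expo (mk3 i j k) Vx = i" "expo (mk3 i j k) Vy = j" "expo (mk3 i j k) Vz = k"
  by (simp_all add: mk3_def lookup_add lookup_single)

lemma monom3_eqI:
  "expo m Vx = expo n Vx \<Longrightarrow> expo m Vy = expo n Vy \<Longrightarrow> expo m Vz = expo n Vz \<Longrightarrow> m = n"
  by (rule poly_mapping_eqI) (metis var.exhaust)

lemma mk3_expo [simp]: "mk3 (expo m Vx) (expo m Vy) (expo m Vz) = m"
  by (rule monom3_eqI) simp_all

lemma mk3_eq_iff [simp]: "mk3 i j k = mk3 i' j' k' \<longleftrightarrow> i = i' \<and> j = j' \<and> k = k'"
  by (metis expo_mk3)

lemma mdeg_eq: "mdeg m = expo m Vx + expo m Vy + expo m Vz"
  by (simp add: mdeg_def UNIV_var)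

lemma mdeg_mk3 [simp]: "mdeg (mk3 i j k) = i + j + k"
  by (simp add: mdeg_eq)

lemma mdeg_add: "mdeg (m + n) = mdeg m + mdeg n"
  by (simp add: mdeg_eq lookup_add)

lemma sum_single_keys: "(\<Sum>m\<in>Poly_Mapping.keys p. Poly_Mapping.single m (Poly_Mapping.lookup p m)) = p"
  by (rule poly_mapping_eqI) (auto simp: lookup_sum lookup_single when_def in_keys_iff)

text \<open>Termwise extension from monomials, a ring homomorphism under the conditions of
  \<open>mono_hom\<close>. The diagonal action and the dehomogenisation are both instances.\<close>

definition mono_ext :: "(monom3 \<Rightarrow> 'k::field \<Rightarrow> 'r::comm_ring_1) \<Rightarrow> 'k poly3 \<Rightarrow> 'r" where
  "mono_ext F p = (\<Sum>m\<in>Poly_Mapping.keys p. F m (Poly_Mapping.lookup p m))"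

locale mono_hom =
  fixes F :: "monom3 \<Rightarrow> 'k::field \<Rightarrow> 'r::comm_ring_1"
  assumes F_0 [simp]: "F m 0 = 0"
    and F_add: "F m (c + c') = F m c + F m c'"
    and F_one: "F 0 1 = 1"
    and F_mult: "F (m + n) (c * c') = F m c * F n c'"
begin

lemma ext_superset:
  "finite A \<Longrightarrow> Poly_Mapping.keys p \<subseteq> A \<Longrightarrow> mono_ext F p = (\<Sum>m\<in>A. F m (Poly_Mapping.lookup p m))"
  unfolding mono_ext_def by (rule sum.mono_neutral_left) (auto simp: in_keys_iff)

lemma ext_0 [simp]: "mono_ext F 0 = 0"
  by (simp add: mono_ext_def)

lemma ext_single [simp]: "mono_ext F (Poly_Mapping.single m c) = F m c"
  by (cases "c = 0") (simp_all add: mono_ext_def)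

lemma ext_1 [simp]: "mono_ext F 1 = 1"
  using ext_single[of 0 1] by (simp add: F_one)

lemma ext_add: "mono_ext F (p + q) = mono_ext F p + mono_ext F q"
proof -
  let ?A = "Poly_Mapping.keys p \<union> Poly_Mapping.keys q"
  have "mono_ext F (p + q) = (\<Sum>m\<in>?A. F m (Poly_Mapping.lookup (p + q) m))"
    by (rule ext_superset) (auto dest: subsetD[OF keys_add])
  also have "\<dots> = mono_ext F p + mono_ext F q"
    by (simp add: lookup_add F_add sum.distrib ext_superset[of ?A])
  finally show ?thesis .
qed

lemma ext_sum: "mono_ext F (\<Sum>i\<in>A. f i) = (\<Sum>i\<in>A. mono_ext F (f i))"
  by (induction A rule: infinite_finite_induct) (simp_all add: ext_add)

lemma ext_mult: "mono_ext F (p * q) = mono_ext F p * mono_ext F q"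
proof -
  have "p * q = (\<Sum>m\<in>Poly_Mapping.keys p. \<Sum>n\<in>Poly_Mapping.keys q.
      Poly_Mapping.single (m + n) (Poly_Mapping.lookup p m * Poly_Mapping.lookup q n))"
    by (subst (1) sum_single_keys[of p, symmetric], subst (1) sum_single_keys[of q, symmetric])
      (simp add: sum_product mult_single)
  then have "mono_ext F (p * q) = (\<Sum>m\<in>Poly_Mapping.keys p. \<Sum>n\<in>Poly_Mapping.keys q.
      F m (Poly_Mapping.lookup p m) * F n (Poly_Mapping.lookup q n))"
    by (simp add: ext_sum F_mult)
  then show ?thesis by (simp add: mono_ext_def sum_product)
qed

lemma ext_prod: "mono_ext F (\<Prod>i\<in>A. f i) = (\<Prod>i\<in>A. mono_ext F (f i))"
  by (induction A rule: infinite_finite_induct) (simp_all add: ext_mult)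

end

subsection \<open>Diagonal actions\<close>

lemma single_power:
  "(Poly_Mapping.single (Poly_Mapping.single v 1) c :: 'k::field poly3) ^ n = Poly_Mapping.single (Poly_Mapping.single v n) (c ^ n)"
  by (induction n) (simp_all add: mult_single flip: single_add)

lemma diag_term:
  "Poly_Mapping.single 0 x * (\<Prod>v\<in>UNIV. Poly_Mapping.single (Poly_Mapping.single v 1) (c v) ^ expo m v) =
   Poly_Mapping.single m (x * (\<Prod>v\<in>UNIV. c v ^ expo m v) :: 'k::field)"
proof -
  have m: "Poly_Mapping.single Vx (expo m Vx) + (Poly_Mapping.single Vy (expo m Vy) + Poly_Mapping.single Vz (expo m Vz)) = m"
    using mk3_expo[of m] by (simp add: mk3_def add.assoc)
  show ?thesis unfolding single_power by (simp add: UNIV_var mult_single m)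
qed

lemma diag_act_eq:
  "diag_act c p = mono_ext (\<lambda>m x. Poly_Mapping.single m (x * (\<Prod>v\<in>UNIV. c v ^ expo m v))) p"
  unfolding diag_act_def subst_def mono_ext_def diag_term ..

lemma lookup_diag_act:
  "Poly_Mapping.lookup (diag_act c p) m = Poly_Mapping.lookup p m * (\<Prod>v\<in>UNIV. c v ^ expo m v)"
  by (auto simp: diag_act_eq mono_ext_def lookup_sum lookup_single when_def in_keys_iff)

interpretation diag: mono_hom "\<lambda>m x. Poly_Mapping.single m (x * (\<Prod>v\<in>UNIV. c v ^ expo m v))" for c :: "var \<Rightarrow> 'k::field"
  by unfold_locales
    (simp_all add: single_add distrib_right mult_single lookup_add power_add prod.distrib ac_simps)

lemma diag_act_mult: "diag_act c (p * q) = diag_act c p * diag_act c q"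
  by (simp add: diag_act_eq diag.ext_mult)

lemma diag_act_prod: "diag_act c (\<Prod>i\<in>A. f i) = (\<Prod>i\<in>A. diag_act c (f i))"
  by (simp add: diag_act_eq diag.ext_prod)

lemma diag_act_compose: "diag_act c (diag_act c' p) = diag_act (\<lambda>v. c v * c' v) p"
  by (rule poly_mapping_eqI) (simp add: lookup_diag_act power_mult_distrib prod.distrib ac_simps)

lemma diag_act_1 [simp]: "diag_act (\<lambda>v. 1) p = p"
  by (rule poly_mapping_eqI) (simp add: lookup_diag_act)

text \<open>Monomials are eigenvectors of a diagonal action, so invariance can be tested term by
  term.\<close>

lemma diag_invariant_iff:
  "diag_invariant c p \<longleftrightarrow> (\<forall>m\<in>Poly_Mapping.keys p. (\<Prod>v\<in>UNIV. c v ^ expo m v) = 1)"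
  by (auto simp: diag_invariant_def poly_mapping_eq_iff fun_eq_iff lookup_diag_act in_keys_iff)

subsection \<open>Forms\<close>

lemma form_0 [simp]: "form n 0"
  by (simp add: form_def)

lemma form_single [simp]: "form n (Poly_Mapping.single m c) \<longleftrightarrow> c = 0 \<or> mdeg m = n"
  by (cases "c = 0") (simp_all add: form_def)

lemma form_lookup: "form n p \<longleftrightarrow> (\<forall>m. Poly_Mapping.lookup p m \<noteq> 0 \<longrightarrow> mdeg m = n)"
  by (auto simp: form_def in_keys_iff)

lemma form_diag_act: "form n p \<Longrightarrow> form n (diag_act c p)"
  by (simp add: form_lookup lookup_diag_act)

lemma form_add: "form n p \<Longrightarrow> form n q \<Longrightarrow> form n (p + q)"
  unfolding form_def using keys_add[of p q] by blast

lemma form_minus: "form n p \<Longrightarrow> form n q \<Longrightarrow> form n (p - q)"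
  unfolding form_lookup lookup_minus by (metis diff_self)

lemma form_mult: "form n p \<Longrightarrow> form k q \<Longrightarrow> form (n + k) (p * q)"
  unfolding form_def using keys_mult[of p q] by (fastforce simp: mdeg_add)

lemma form_prod: "finite A \<Longrightarrow> (\<And>i. i \<in> A \<Longrightarrow> form 1 (f i)) \<Longrightarrow> form (card A) (\<Prod>i\<in>A. f i)"
proof (induction A rule: finite_induct)
  case empty
  show ?case by (simp add: mdeg_eq flip: single_one)
next
  case (insert x A)
  then show ?case using form_mult[of 1 "f x" "card A" "\<Prod>i\<in>A. f i"] by simp
qed

subsection \<open>Dehomogenisation\<close>

text \<open>Sets \<open>z = 1\<close>, with \<open>x\<close> as outer and \<open>y\<close> as inner
  variable. The translates of \<open>x + y + z\<close> become monic and linear in \<open>x\<close>,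
  so divisibility by them can be read off from roots.\<close>

definition dehom :: "'k::field poly3 \<Rightarrow> 'k poly poly" where
  "dehom = mono_ext (\<lambda>m c. monom (monom c (expo m Vy)) (expo m Vx))"

interpretation dehom: mono_hom "\<lambda>m c. monom (monom c (expo m Vy)) (expo m Vx) :: 'k::field poly poly"
  by unfold_locales (simp_all add: add_monom lookup_add mult_monom monom_0 one_pCons)

lemmas dehom_mult = dehom.ext_mult[folded dehom_def]
  and dehom_prod = dehom.ext_prod[folded dehom_def]
  and dehom_add = dehom.ext_add[folded dehom_def]
  and dehom_single = dehom.ext_single[folded dehom_def]
  and dehom_0 = dehom.ext_0[folded dehom_def]

text \<open>Nothing is lost on forms of a fixed degree: the exponent of \<open>z\<close> is
  recovered from the other two.\<close>

lemma coeff_dehom: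
  assumes "form n p" "mdeg m = n"
  shows "coeff (coeff (dehom p) (expo m Vx)) (expo m Vy) = Poly_Mapping.lookup p m"
proof -
  have "coeff (coeff (dehom p) (expo m Vx)) (expo m Vy) = (\<Sum>k\<in>Poly_Mapping.keys p.
      if k = m then Poly_Mapping.lookup p k else 0)"
    unfolding dehom_def mono_ext_def coeff_sum
  proof (rule sum.cong[OF refl])
    fix k assume "k \<in> Poly_Mapping.keys p"
    then have "mdeg k = mdeg m" using assms by (simp add: form_def)
    then have "expo k Vx = expo m Vx \<and> expo k Vy = expo m Vy \<longleftrightarrow> k = m"
      by (auto simp: mdeg_eq intro: monom3_eqI)
    then show "coeff (coeff (monom (monom (Poly_Mapping.lookup p k) (expo k Vy)) (expo k Vx)) (expo m Vx)) (expo m Vy) =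
        (if k = m then Poly_Mapping.lookup p k else 0)"
      by auto
  qed
  then show ?thesis by (simp add: in_keys_iff)
qed

lemma dehom_eq_0:
  assumes "form n p" "dehom p = 0"
  shows "p = 0"
proof (rule poly_mapping_eqI)
  fix m
  show "Poly_Mapping.lookup p m = Poly_Mapping.lookup 0 m"
    using coeff_dehom[OF assms(1), of m] assms by (cases "mdeg m = n") (auto simp: form_lookup)
qed

lemma degree_dehom_le: "form n p \<Longrightarrow> degree (dehom p) \<le> n"
  unfolding dehom_def mono_ext_def
proof (rule degree_sum_le)
  fix m assume "form n p" "m \<in> Poly_Mapping.keys p"
  then have "expo m Vx \<le> n" by (auto simp: form_def mdeg_eq)
  then show "degree (monom (monom (Poly_Mapping.lookup p m) (expo m Vy)) (expo m Vx)) \<le> n"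
    using degree_monom_le le_trans by blast
qed simp

subsection \<open>Monomial ideals\<close>

interpretation polyring: cring "polyring :: 'k::field poly3 ring"
  by (rule cring_polyring)

lemma polyring_simps [simp]:
  "carrier (polyring :: 'k::field poly3 ring) = UNIV" "x \<otimes>\<^bsub>polyring\<^esub> y = x * y" "x \<oplus>\<^bsub>polyring\<^esub> y = x + y"
  "\<zero>\<^bsub>(polyring :: 'k::field poly3 ring)\<^esub> = 0" "\<one>\<^bsub>(polyring :: 'k::field poly3 ring)\<^esub> = 1"
  by (simp_all add: polyring_def)

lemma polyring_a_inv [simp]: "\<ominus>\<^bsub>polyring\<^esub> x = - (x :: 'k::field poly3)"
  by (rule polyring.minus_equality) simp_all

lemma polyring_a_minus [simp]: "x \<ominus>\<^bsub>polyring\<^esub> y = x - (y :: 'k::field poly3)"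
  by (simp add: a_minus_def)

lemma polyring_idealI:
  fixes J :: "'k::field poly3 set"
  assumes "0 \<in> J" "\<And>p q. p \<in> J \<Longrightarrow> q \<in> J \<Longrightarrow> p + q \<in> J" "\<And>p q. q \<in> J \<Longrightarrow> p * q \<in> J"
  shows "ideal J polyring"
proof (rule idealI)
  have inv: "- p \<in> J" if "p \<in> J" for p using assms(3)[OF that, of "- 1"] by simp
  show "subgroup J (add_monoid polyring)"
    by (rule polyring.add.subgroupI) (use assms inv in \<open>auto simp: a_inv_def[symmetric]\<close>)
qed (use assms in \<open>auto simp: polyring.ring_axioms mult.commute\<close>)

text \<open>This turns ideal membership into a condition on the support: the right-hand side is an
  ideal containing the generators, and each term of its elements is a multiple of a
  generator.\<close>

lemma Idl_monomials:
  fixes S :: "monom3 set"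
  shows "Idl\<^bsub>polyring\<^esub> (mon ` S) = {p :: 'k::field poly3. \<forall>m\<in>Poly_Mapping.keys p. \<exists>s\<in>S. \<exists>n. m = s + n}"
    (is "?I = ?J")
proof
  have "ideal ?J polyring"
  proof (rule polyring_idealI)
    fix p q assume "p \<in> ?J" "q \<in> ?J"
    then show "p + q \<in> ?J" using keys_add[of p q] by blast
  next
    fix p q assume q: "q \<in> ?J"
    have "\<exists>s\<in>S. \<exists>n. m = s + n" if "m \<in> Poly_Mapping.keys (p * q)" for m
    proof -
      obtain k l where kl: "m = k + l" "l \<in> Poly_Mapping.keys q"
        using \<open>m \<in> _\<close> keys_mult[of p q] by blast
      then obtain s n where "s \<in> S" "l = s + n" using q by blast
      then show ?thesis using kl(1) by (metis add.left_commute)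
    qed
    then show "p * q \<in> ?J" by blast
  qed simp
  moreover have "mon ` S \<subseteq> ?J"
    by (auto intro!: exI[of _ 0] bexI)
  ultimately show "?I \<subseteq> ?J" by (rule polyring.genideal_minimal)
  have I: "ideal ?I polyring" by (rule polyring.genideal_ideal) simp
  show "?J \<subseteq> ?I"
  proof
    fix p assume p: "p \<in> ?J"
    have single: "Poly_Mapping.single m c \<in> ?I" if "m \<in> Poly_Mapping.keys p" for m c
    proof -
      obtain s n where sn: "s \<in> S" "m = s + n" using p \<open>m \<in> _\<close> by blast
      have "mon s \<in> ?I" using polyring.genideal_self[of "mon ` S"] sn(1) by auto
      then have "Poly_Mapping.single n c * mon s \<in> ?I" using ideal.I_l_closed[OF I] by fastforce
      then show ?thesis by (simp add: mult_single sn(2) add.commute)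
    qed
    have "(\<Sum>m\<in>A. Poly_Mapping.single m (Poly_Mapping.lookup p m)) \<in> ?I" if "finite A" "A \<subseteq> Poly_Mapping.keys p" for A
      using that
    proof (induction A rule: finite_induct)
      case empty
      show ?case using additive_subgroup.zero_closed[OF ideal.axioms(1)[OF I]] by simp
    next
      case (insert m A)
      then show ?case
        using additive_subgroup.a_closed[OF ideal.axioms(1)[OF I]] single by fastforce
    qed
    from this[OF finite_keys order_refl] show "p \<in> ?I" by (simp add: sum_single_keys)
  qed
qed

text \<open>In the degree of the generators a cofactor monomial has degree 0 and hence is 1.\<close>

lemma form_in_Idl_iff:
  fixes p :: "'k::field poly3"
  assumes "form n p" "\<And>s. s \<in> S \<Longrightarrow> mdeg s = n"
  shows "p \<in> Idl\<^bsub>polyring\<^esub> (mon ` S) \<longleftrightarrow> Poly_Mapping.keys p \<subseteq> S"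
proof -
  have "(\<exists>s\<in>S. \<exists>k. m = s + k) \<longleftrightarrow> m \<in> S" if "m \<in> Poly_Mapping.keys p" for m
  proof
    assume "\<exists>s\<in>S. \<exists>k. m = s + k"
    then obtain s k where sk: "s \<in> S" "m = s + k" by blast
    have "mdeg m = n" using assms(1) that by (simp add: form_def)
    then have "mdeg k = 0" using sk assms(2)[of s] by (simp add: mdeg_add)
    then have "k = 0" by (intro monom3_eqI) (simp_all add: mdeg_eq)
    then show "m \<in> S" using sk by simp
  qed (auto intro!: bexI exI[of _ 0])
  then show ?thesis unfolding Idl_monomials by blast
qed

lemma form_low_in_Idl:
  fixes p :: "'k::field poly3"
  assumes "form k p" "k < n" "\<And>s. s \<in> S \<Longrightarrow> mdeg s = n" "p \<in> Idl\<^bsub>polyring\<^esub> (mon ` S)"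
  shows "p = 0"
proof (rule ccontr)
  assume "p \<noteq> 0"
  then obtain m where m: "m \<in> Poly_Mapping.keys p" by (metis all_not_in_conv keys_eq_empty)
  then obtain s l where "s \<in> S" "m = s + l" using assms(4) unfolding Idl_monomials by blast
  then have "n \<le> mdeg m" using assms(3)[of s] by (simp add: mdeg_add)
  then show False using m assms(1,2) by (simp add: form_def)
qed

lemma coset_eq_iff:
  fixes J :: "'k::field poly3 set"
  assumes "ideal J polyring"
  shows "J +>\<^bsub>polyring\<^esub> f = J +>\<^bsub>polyring\<^esub> g \<longleftrightarrow> f - g \<in> J"
  using polyring.quotient_eq_iff_same_a_r_cos[OF assms, of f g] by simp

lemma mult_class_coset:
  fixes J :: "'k::field poly3 set"
  assumes "ideal J polyring"
  shows "mult_class J L (J +>\<^bsub>polyring\<^esub> f) = J +>\<^bsub>polyring\<^esub> (L * f)"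
  using ideal.rcoset_mult_add[OF assms, of L f] by (simp add: mult_class_def FactRing_def)

subsection \<open>Linear algebra\<close>

interpretation poly3: vector_space "\<lambda>c (p :: 'k::field poly3). Poly_Mapping.single 0 c * p"
  by unfold_locales (simp_all add: single_add distrib_left distrib_right mult_single flip: mult.assoc)

lemma lookup_scale: "Poly_Mapping.lookup (Poly_Mapping.single 0 c * p) m = c * Poly_Mapping.lookup (p :: 'k::field poly3) m"
  unfolding mult_map_scale_conv_mult[symmetric] by (simp add: map.rep_eq when_def)

lemma mon_eq_iff [simp]: "(mon m :: 'k::field poly3) = mon n \<longleftrightarrow> m = n"
  by (metis lookup_single_eq lookup_single_not_eq zero_neq_one)

lemma independent_monomials: "poly3.independent (mon ` A :: 'k::field poly3 set)"
  unfolding poly3.independent_explicit_module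
proof (intro allI impI)
  fix t :: "'k poly3 set" and u v
  assume t: "finite t" "t \<subseteq> mon ` A" "(\<Sum>v\<in>t. Poly_Mapping.single 0 (u v) * v) = 0" and v: "v \<in> t"
  obtain m where m: "v = mon m" using t(2) v by blast
  have "0 = Poly_Mapping.lookup (\<Sum>v\<in>t. Poly_Mapping.single 0 (u v) * v) m" using t(3) by simp
  also have "\<dots> = (\<Sum>w\<in>t. if w = v then u w else 0)"
    unfolding lookup_sum
  proof (rule sum.cong[OF refl])
    fix w assume "w \<in> t"
    then obtain n where "w = mon n" using t(2) by blast
    then show "Poly_Mapping.lookup (Poly_Mapping.single 0 (u w) * w) m = (if w = v then u w else 0)"
      by (auto simp: lookup_scale m lookup_single when_def)
  qed
  also have "\<dots> = u v" using t(1) v by simp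
  finally show "u v = 0" by simp
qed

lemma in_span_monomials:
  fixes p :: "'k::field poly3"
  assumes "Poly_Mapping.keys p \<subseteq> A"
  shows "p \<in> poly3.span (mon ` A)"
proof -
  have "(\<Sum>m\<in>Poly_Mapping.keys p. Poly_Mapping.single 0 (Poly_Mapping.lookup p m) * mon m) \<in> poly3.span (mon ` A)"
    by (intro poly3.span_sum poly3.span_scale poly3.span_base) (use assms in auto)
  then show ?thesis by (simp add: mult_single sum_single_keys)
qed

lemma mult_eq_sum_scale:
  fixes L p :: "'k::field poly3"
  shows "L * p = (\<Sum>m\<in>Poly_Mapping.keys p. Poly_Mapping.single 0 (Poly_Mapping.lookup p m) * (L * mon m))"
proof -
  have "L * p = L * (\<Sum>m\<in>Poly_Mapping.keys p. Poly_Mapping.single m (Poly_Mapping.lookup p m))"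
    by (simp add: sum_single_keys)
  also have "\<dots> = (\<Sum>m\<in>Poly_Mapping.keys p. L * (Poly_Mapping.single 0 (Poly_Mapping.lookup p m) * mon m))"
    by (simp add: sum_distrib_left mult_single)
  finally show ?thesis by (simp only: mult.left_commute)
qed

lemma finite_monomials: "finite {m. mdeg m = n}"
proof (rule finite_subset)
  show "{m. mdeg m = n} \<subseteq> (\<lambda>(i, j, k). mk3 i j k) ` ({..n} \<times> {..n} \<times> {..n})"
  proof
    fix m assume "m \<in> {m. mdeg m = n}"
    then have "m = (\<lambda>(i, j, k). mk3 i j k) (expo m Vx, expo m Vy, expo m Vz)"
      "(expo m Vx, expo m Vy, expo m Vz) \<in> {..n} \<times> {..n} \<times> {..n}"
      by (auto simp: mdeg_eq)
    then show "m \<in> (\<lambda>(i, j, k). mk3 i j k) ` ({..n} \<times> {..n} \<times> {..n})" by (rule image_eqI)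
  qed
qed simp

text \<open>Those divisible by \<open>x\<close> correspond to the monomials of degree
  \<open>n\<close>; the other \<open>n + 2\<close> involve only \<open>y\<close> and
  \<open>z\<close>. This surplus is the bound on the number of generators in
  \<open>not_max_rank_at\<close>.\<close>

lemma card_monomials_Suc: "card {m. mdeg m = Suc n} = card {m. mdeg m = n} + (n + 2)"
proof -
  let ?A = "(\<lambda>m. m + Poly_Mapping.single Vx 1) ` {m. mdeg m = n}"
  let ?B = "(\<lambda>j. mk3 0 j (Suc n - j)) ` {..Suc n}"
  have "m \<in> ?A \<union> ?B" if m: "mdeg m = Suc n" for m
  proof (cases "expo m Vx")
    case 0
    then have "m = mk3 0 (expo m Vy) (Suc n - expo m Vy)"
      using m by (intro monom3_eqI) (auto simp: mdeg_eq)
    then show ?thesis using m 0 by (auto simp: mdeg_eq intro!: image_eqI[of m _ "expo m Vy"])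
  next
    case (Suc i)
    then have "m = mk3 i (expo m Vy) (expo m Vz) + Poly_Mapping.single Vx 1"
      by (intro monom3_eqI) (auto simp: lookup_add lookup_single)
    then show ?thesis using m Suc by (auto simp: mdeg_eq intro!: image_eqI[of m _ "mk3 i (expo m Vy) (expo m Vz)"])
  qed
  then have "{m. mdeg m = Suc n} = ?A \<union> ?B"
    by (auto simp: mdeg_eq lookup_add lookup_single)
  moreover have "?A \<inter> ?B = {}"
  proof -
    have "expo m Vx \<noteq> 0" if "m \<in> ?A" for m using that by (auto simp: lookup_add lookup_single)
    moreover have "expo m Vx = 0" if "m \<in> ?B" for m using that by auto
    ultimately show ?thesis by blast
  qed
  moreover have "card ?A = card {m. mdeg m = n}" by (rule card_image) (simp add: inj_on_def)
  moreover have "card ?B = n + 2"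
  proof -
    have "inj_on (\<lambda>j. mk3 0 j (Suc n - j)) {..Suc n}" by (rule inj_onI) (metis expo_mk3(2))
    then show ?thesis by (simp add: card_image)
  qed
  ultimately show ?thesis
    using card_Un_disjoint[of ?A ?B] finite_monomials by simp
qed

subsection \<open>Failure of maximal rank\<close>

text \<open>
  The generators are few enough that the source has at most the dimension of the target, so
  surjectivity would force injectivity.
\<close>

lemma not_max_rank_at:
  fixes f L :: "'k::field poly3"
  assumes S: "\<And>s. s \<in> S \<Longrightarrow> mdeg s = Suc n" and card: "card S \<le> n + 2"
    and L: "form 1 L" and f: "form n f" "f \<noteq> 0" and Lf: "L * f \<in> Idl\<^bsub>polyring\<^esub> (mon ` S)"
  shows "\<not> max_rank_at (Idl\<^bsub>polyring\<^esub> (mon ` S)) n L"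
proof -
  let ?I = "Idl\<^bsub>polyring\<^esub> (mon ` S) :: 'k poly3 set"
  have I: "ideal ?I polyring" by (rule polyring.genideal_ideal) simp
  have finS: "finite S" by (rule finite_subset[OF _ finite_monomials[of "Suc n"]]) (use S in auto)
  have "\<not> inj_on (mult_class ?I L) (quot_component ?I n)"
  proof
    assume inj: "inj_on (mult_class ?I L) (quot_component ?I n)"
    have "mult_class ?I L (?I +>\<^bsub>polyring\<^esub> f) = mult_class ?I L (?I +>\<^bsub>polyring\<^esub> 0)"
      unfolding mult_class_coset[OF I] coset_eq_iff[OF I] using Lf by simp
    moreover have "?I +>\<^bsub>polyring\<^esub> f \<in> quot_component ?I n" "?I +>\<^bsub>polyring\<^esub> 0 \<in> quot_component ?I n"
      unfolding quot_component_def using f(1) by (blast intro: form_0)+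
    ultimately have "?I +>\<^bsub>polyring\<^esub> f = ?I +>\<^bsub>polyring\<^esub> 0" by (rule inj_onD[OF inj])
    then have "f \<in> ?I" unfolding coset_eq_iff[OF I] by simp
    then show False using form_low_in_Idl[OF f(1) _ S, of S] f(2) by simp
  qed
  moreover have "mult_class ?I L ` quot_component ?I n \<noteq> quot_component ?I (Suc n)"
  proof
    assume surj: "mult_class ?I L ` quot_component ?I n = quot_component ?I (Suc n)"
    obtain m0 where m0: "m0 \<in> Poly_Mapping.keys f"
      using f(2) by (metis all_not_in_conv keys_eq_empty)
    let ?M = "{m. mdeg m = n}"
    \<comment> \<open>Under surjectivity the products \<open>L * mon m\<close> and the generators
      span all forms of degree \<open>n + 1\<close>. The relation given by \<open>f\<close> makes
      the product at \<open>m0\<close> redundant, which leaves too few spanning vectors.\<close>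
    define T where "T = (\<lambda>m. L * mon m) ` (?M - {m0}) \<union> mon ` S"
    have m0M: "m0 \<in> ?M" using f(1) m0 by (simp add: form_def)
    have finT: "finite T" unfolding T_def using finite_monomials finS by blast
    have "card T \<le> card ((\<lambda>m. L * mon m) ` (?M - {m0})) + card (mon ` S :: 'k poly3 set)"
      unfolding T_def by (rule card_Un_le)
    also have "\<dots> \<le> card (?M - {m0}) + card S"
      by (intro add_mono card_image_le finS finite_Diff finite_monomials)
    also have "\<dots> < card ?M + (n + 2)"
      using card m0M finite_monomials[of n] card_gt_0_iff[of ?M] by (auto simp: card_Diff_singleton)
    finally have card_T: "card T < card {m. mdeg m = Suc n}" by (simp add: card_monomials_Suc)
    have in_I: "p \<in> poly3.span T" if "p \<in> ?I" "form (Suc n) p" for p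
    proof -
      have "Poly_Mapping.keys p \<subseteq> S" using form_in_Idl_iff[OF that(2) S] that(1) by blast
      then have "p \<in> poly3.span (mon ` S)" by (rule in_span_monomials)
      then show ?thesis using poly3.span_mono[of "mon ` S" T] unfolding T_def by blast
    qed
    have Lm: "L * mon m \<in> poly3.span T" if "mdeg m = n" for m
    proof (cases "m = m0")
      case False
      then show ?thesis using that by (intro poly3.span_base) (auto simp: T_def)
    next
      case True
      \<comment> \<open>The product at \<open>m0\<close> is solved for in the expansion of
        \<open>L * f\<close>, which lies in the span of the generators.\<close>
      let ?t = "\<lambda>m. Poly_Mapping.single 0 (Poly_Mapping.lookup f m) * (L * mon m)"
      have "L * f = (\<Sum>m\<in>Poly_Mapping.keys f. ?t m)" by (rule mult_eq_sum_scale)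
      also have "\<dots> = ?t m0 + (\<Sum>m\<in>Poly_Mapping.keys f - {m0}. ?t m)"
        by (rule sum.remove) (use m0 in auto)
      finally have t: "?t m0 = L * f - (\<Sum>m\<in>Poly_Mapping.keys f - {m0}. ?t m)" by simp
      have "(\<Sum>m\<in>Poly_Mapping.keys f - {m0}. ?t m) \<in> poly3.span T"
        by (intro poly3.span_sum poly3.span_scale poly3.span_base) (use f(1) in \<open>auto simp: T_def form_def\<close>)
      moreover have "L * f \<in> poly3.span T"
        by (rule in_I[OF Lf]) (use form_mult[OF L f(1)] in simp)
      ultimately have "?t m0 \<in> poly3.span T"
        unfolding t by (intro poly3.span_diff)
      then have "Poly_Mapping.single 0 (inverse (Poly_Mapping.lookup f m0)) * ?t m0 \<in> poly3.span T"
        by (rule poly3.span_scale)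
      moreover have "Poly_Mapping.lookup f m0 \<noteq> 0" using m0 by (simp add: in_keys_iff)
      ultimately show ?thesis using True by (simp add: mult_single flip: mult.assoc)
    qed
    have "mon ` {m. mdeg m = Suc n} \<subseteq> poly3.span T"
    proof
      fix w :: "'k poly3" assume "w \<in> mon ` {m. mdeg m = Suc n}"
      then have w: "form (Suc n) w" by auto
      then have "?I +>\<^bsub>polyring\<^esub> w \<in> quot_component ?I (Suc n)"
        unfolding quot_component_def by blast
      then have "?I +>\<^bsub>polyring\<^esub> w \<in> mult_class ?I L ` quot_component ?I n"
        unfolding surj .
      then obtain g where g: "form n g" "?I +>\<^bsub>polyring\<^esub> w = ?I +>\<^bsub>polyring\<^esub> (L * g)"
        unfolding quot_component_def by (auto simp: mult_class_coset[OF I])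
      have "w - L * g \<in> poly3.span T"
        by (rule in_I) (use g w form_mult[OF L g(1)] in \<open>auto simp: coset_eq_iff[OF I] intro: form_minus\<close>)
      moreover have "L * g \<in> poly3.span T"
        unfolding mult_eq_sum_scale[of L g]
        by (intro poly3.span_sum poly3.span_scale Lm) (use g(1) in \<open>auto simp: form_def\<close>)
      ultimately have "(w - L * g) + L * g \<in> poly3.span T" by (rule poly3.span_add)
      then show "w \<in> poly3.span T" by simp
    qed
    then have "card (mon ` {m. mdeg m = Suc n} :: 'k poly3 set) \<le> card T"
      using poly3.independent_span_bound[OF finT independent_monomials] by blast
    moreover have "card (mon ` {m. mdeg m = Suc n} :: 'k poly3 set) = card {m. mdeg m = Suc n}"
      by (rule card_image) (simp add: inj_on_def)
    ultimately show False using card_T by simp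
  qed
  ultimately show ?thesis by (simp add: max_rank_at_def)
qed

subsection \<open>Artinian monomial ideals\<close>

text \<open>From an index of minimal dimension on nothing can shrink: a vector lost later would
  extend a basis \<open>B\<close> of the smaller space to more independent vectors than
  \<open>C\<close> has.\<close>

lemma (in vector_space) decreasing_subspaces_stabilize:
  assumes T: "finite T" and W: "\<And>n. subspace (W n)" "\<And>n. W n \<subseteq> span T" "\<And>n. W (Suc n) \<subseteq> W n"
  shows "\<exists>n. \<forall>m\<ge>n. W m = W n"
proof -
  obtain n where n: "\<And>m. dim (W n) \<le> dim (W m)"
    using ex_has_least_nat[of "\<lambda>_. True" _ "\<lambda>n. dim (W n)"] by auto
  have "W m = W n" if "n \<le> m" for m
  proof
    show sub: "W m \<subseteq> W n" by (rule lift_Suc_antimono_le[of W]) (use W(3) that in auto)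
    show "W n \<subseteq> W m"
    proof
      fix x assume x: "x \<in> W n"
      obtain B where B: "B \<subseteq> W m" "independent B" "W m \<subseteq> span B" "card B = dim (W m)"
        by (rule basis_exists)
      obtain C where C: "C \<subseteq> W n" "independent C" "W n \<subseteq> span C" "card C = dim (W n)"
        by (rule basis_exists)
      have finB: "finite B" and finC: "finite C"
        using independent_span_bound[OF T] B(1,2) C(1,2) W(2) by blast+
      show "x \<in> W m"
      proof (rule ccontr)
        assume "x \<notin> W m"
        then have "x \<notin> span B" using span_minimal[OF B(1) W(1)] by blast
        then have "independent (insert x B)" "x \<notin> B"
          using B(2) independent_insertI span_base by blast+
        moreover have "insert x B \<subseteq> span C" using x B(1) sub C(3) by blast
        ultimately have "Suc (card B) \<le> card C"
          using independent_span_bound[OF finC] finB by fastforce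
        then show False using n[of m] B(4) C(4) by simp
      qed
    qed
  qed
  then show ?thesis by blast
qed

text \<open>The pure powers in \<open>S\<close> make the quotient finite-dimensional, spanned by the
  monomials in \<open>box\<close>. A chain of ideals is followed through the subspaces
  \<open>W n\<close> of polynomials supported there.\<close>

lemma artinian_monomial_ideal:
  assumes S: "mk3 d 0 0 \<in> S" "mk3 0 d 0 \<in> S" "mk3 0 0 d \<in> S"
  shows "artinian_ideal (Idl\<^bsub>polyring\<^esub> (mon ` S) :: 'k::field poly3 set)"
proof -
  let ?I = "Idl\<^bsub>polyring\<^esub> (mon ` S) :: 'k poly3 set"
  let ?Q = "polyring Quot ?I"
  let ?h = "\<lambda>p. ?I +>\<^bsub>polyring\<^esub> p"
  have I: "ideal ?I polyring" by (rule polyring.genideal_ideal) simp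
  have hom: "?h \<in> Ring.ring_hom polyring ?Q" by (rule ideal.rcos_ring_hom[OF I])
  define box where "box = (\<lambda>(i, j, k). mk3 i j k) ` ({..<d} \<times> {..<d} \<times> {..<d})"
  have fin_box: "finite (mon ` box :: 'k poly3 set)" by (simp add: box_def)
  have outside: "\<exists>s\<in>S. \<exists>n. m = s + n" if "m \<notin> box" for m
  proof -
    have "d \<le> expo m Vx \<or> d \<le> expo m Vy \<or> d \<le> expo m Vz"
    proof (rule ccontr)
      assume "\<not> ?thesis"
      then have "m \<in> box" unfolding box_def
        by (intro image_eqI[of _ _ "(expo m Vx, expo m Vy, expo m Vz)"]) auto
      then show False using that by simp
    qed
    moreover have "d \<le> expo m Vx \<Longrightarrow> m = mk3 d 0 0 + mk3 (expo m Vx - d) (expo m Vy) (expo m Vz)"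
      "d \<le> expo m Vy \<Longrightarrow> m = mk3 0 d 0 + mk3 (expo m Vx) (expo m Vy - d) (expo m Vz)"
      "d \<le> expo m Vz \<Longrightarrow> m = mk3 0 0 d + mk3 (expo m Vx) (expo m Vy) (expo m Vz - d)"
      by (auto intro!: monom3_eqI simp: lookup_add)
    ultimately show ?thesis using S by blast
  qed
  have reduce: "\<exists>q. Poly_Mapping.keys q \<subseteq> box \<and> ?h q = ?h p" for p
  proof -
    define q where "q = (\<Sum>m\<in>Poly_Mapping.keys p \<inter> box. Poly_Mapping.single m (Poly_Mapping.lookup p m))"
    have lookup_q: "Poly_Mapping.lookup q m = (if m \<in> box then Poly_Mapping.lookup p m else 0)" for m
      by (auto simp: q_def lookup_sum lookup_single when_def in_keys_iff)
    have "Poly_Mapping.keys q \<subseteq> box" by (auto simp: in_keys_iff lookup_q split: if_splits)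
    moreover have "q - p \<in> ?I"
      unfolding Idl_monomials by (auto simp: in_keys_iff lookup_minus lookup_q outside split: if_splits)
    ultimately show ?thesis using coset_eq_iff[OF I] by blast
  qed
  have "\<exists>n. \<forall>m\<ge>n. A m = A n" if A: "\<forall>n. ideal (A n) ?Q \<and> A (Suc n) \<subseteq> A n" for A
  proof -
    define W where "W n = {p. Poly_Mapping.keys p \<subseteq> box \<and> ?h p \<in> A n}" for n
    have "poly3.subspace (W n)" for n
    proof -
      have An: "ideal (A n) ?Q" using A by blast
      have zero: "?h 0 \<in> A n"
        using additive_subgroup.zero_closed[OF ideal.axioms(1)[OF An]] ring_hom_zero[OF hom polyring.ring_axioms ideal.axioms(2)[OF An]]
        by simp
      have add: "?h (p + q) \<in> A n" if "?h p \<in> A n" "?h q \<in> A n" for p q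
        using additive_subgroup.a_closed[OF ideal.axioms(1)[OF An] that] ring_hom_add[OF hom, of p q] by simp
      have mult: "?h (r * p) \<in> A n" if "?h p \<in> A n" for p r
        using ideal.I_l_closed[OF An that, of "?h r"] ring_hom_mult[OF hom, of r p] ring_hom_closed[OF hom, of r] by simp
      have keys_scale: "Poly_Mapping.keys (Poly_Mapping.single 0 c * p) \<subseteq> Poly_Mapping.keys p" for c :: 'k and p :: "'k poly3"
        by (auto simp: in_keys_iff lookup_scale)
      show ?thesis
      proof (rule poly3.subspaceI)
        show "0 \<in> W n" using zero by (simp add: W_def)
        show "p + q \<in> W n" if "p \<in> W n" "q \<in> W n" for p q
          using that add[of p q] keys_add[of p q] by (auto simp: W_def)
        show "Poly_Mapping.single 0 c * p \<in> W n" if "p \<in> W n" for c p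
          using that mult[of p] keys_scale[of c p] by (auto simp: W_def)
      qed
    qed
    moreover have "W n \<subseteq> poly3.span (mon ` box)" for n
      by (auto simp: W_def intro: in_span_monomials)
    moreover have "W (Suc n) \<subseteq> W n" for n using A by (auto simp: W_def)
    ultimately obtain n where n: "\<And>m. n \<le> m \<Longrightarrow> W m = W n"
      using poly3.decreasing_subspaces_stabilize[OF fin_box, of W] by blast
    \<comment> \<open>\<open>W k\<close> determines \<open>A k\<close>, since every coset has a
      representative supported in \<open>box\<close>.\<close>
    have "A k \<subseteq> A m" if "W k \<subseteq> W m" for k m
    proof
      fix x assume x: "x \<in> A k"
      then have "x \<in> carrier ?Q" using A by (meson ideal.Icarr)
      then obtain p where p: "x = ?h p" by (auto simp: FactRing_def A_RCOSETS_def')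
      obtain q where q: "Poly_Mapping.keys q \<subseteq> box" "?h q = x" using reduce[of p] p by blast
      then have "q \<in> W m" using x that by (auto simp: W_def)
      then show "x \<in> A m" using q by (simp add: W_def)
    qed
    then have "A m = A n" if "n \<le> m" for m using n[OF that] by blast
    then show ?thesis by blast
  qed
  then show ?thesis
    using I ideal.quotient_is_ring[OF I] by (simp add: artinian_ideal_def artinian_ring_def)
qed

subsection \<open>Counting invariant monomials\<close>

context circulant_steps
begin

definition invariant_monomials :: "monom3 set" where
  "invariant_monomials = {m. mdeg m = d \<and> d dvd a * expo m Vy + b * expo m Vz}"

text \<open>
  Apart from the three pure powers, an invariant monomial is determined by the residue \<open>t\<close>
  with \<open>t * a \<equiv> z\<close> and \<open>t * b \<equiv> - y\<close>, and \<open>t\<close> is neither \<open>0\<close> nor \<open>- 1\<close>.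
\<close>

lemma card_invariant_monomials:
  assumes "3 \<le> d"
  shows "finite invariant_monomials" "card invariant_monomials \<le> d + 1"
proof -
  show fin: "finite invariant_monomials"
    by (rule finite_subset[OF _ finite_monomials[of d]]) (auto simp: invariant_monomials_def)
  let ?C = "{mk3 d 0 0, mk3 0 d 0, mk3 0 0 d}"
  define P where "P m t \<longleftrightarrow> t < d \<and> [int t * int a = int (expo m Vz)] (mod int d) \<and>
    [int t * int b = - int (expo m Vy)] (mod int d)" for m t
  have ex: "\<exists>t. P m t" if m: "m \<in> invariant_monomials" for m
  proof -
    obtain t where t: "[t * int a = int (expo m Vz)] (mod int d)" "[t * int b = - int (expo m Vy)] (mod int d)"
      using ex_slope[of "expo m Vy" "expo m Vz"] m unfolding invariant_monomials_def by blast
    have d0: "0 < int d" using assms by simp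
    have "P m (nat (t mod int d))"
      using t d0 by (simp add: P_def cong_def mod_mult_left_eq nat_less_iff)
    then show ?thesis ..
  qed
  define \<tau> where "\<tau> m = (SOME t. P m t)" for m
  have \<tau>: "P m (\<tau> m)" if "m \<in> invariant_monomials" for m
    unfolding \<tau>_def using ex[OF that] by (rule someI_ex)
  \<comment> \<open>Away from the pure powers the exponents of \<open>y\<close> and \<open>z\<close>
    are below \<open>d\<close>, hence determined by their residues.\<close>
  have small: "expo m Vy < d \<and> expo m Vz < d \<and> (expo m Vy \<noteq> 0 \<or> expo m Vz \<noteq> 0)"
    if "m \<in> invariant_monomials - ?C" for m
  proof (rule ccontr)
    assume neg: "\<not> ?thesis"
    have deg: "expo m Vx + expo m Vy + expo m Vz = d" using that by (simp add: invariant_monomials_def mdeg_eq)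
    consider "expo m Vy = d" | "expo m Vz = d" | "expo m Vx = d" using neg deg by linarith
    then have "m \<in> ?C"
      using deg by cases (auto intro!: monom3_eqI)
    then show False using that by blast
  qed
  have eqI: "i = j" if "[int i = int j] (mod int d)" "i < d" "j < d" for i j
    using that cong_less_modulus_unique_nat by (auto simp: cong_int_iff)
  have "inj_on \<tau> (invariant_monomials - ?C)"
  proof (rule inj_onI)
    fix m n assume mn: "m \<in> invariant_monomials - ?C" "n \<in> invariant_monomials - ?C" "\<tau> m = \<tau> n"
    have Pm: "P m (\<tau> m)" and Pn: "P n (\<tau> m)" using \<tau>[of m] \<tau>[of n] mn by auto
    have "[int (expo m Vz) = int (expo n Vz)] (mod int d)"
      using Pm Pn unfolding P_def by (meson cong_sym cong_trans)
    moreover have "[- int (expo m Vy) = - int (expo n Vy)] (mod int d)"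
      using Pm Pn unfolding P_def by (meson cong_sym cong_trans)
    ultimately have "expo m Vz = expo n Vz" "expo m Vy = expo n Vy"
      using small[OF mn(1)] small[OF mn(2)] by (auto intro!: eqI simp: cong_minus_minus_iff)
    moreover have "mdeg m = mdeg n" using mn by (simp add: invariant_monomials_def)
    ultimately show "m = n" by (intro monom3_eqI) (auto simp: mdeg_eq)
  qed
  moreover have "\<tau> ` (invariant_monomials - ?C) \<subseteq> {1..d - 2}"
  proof
    fix t assume "t \<in> \<tau> ` (invariant_monomials - ?C)"
    then obtain m where m: "m \<in> invariant_monomials - ?C" "t = \<tau> m" by blast
    have P: "P m t" using \<tau> m by blast
    have "t \<noteq> 0"
    proof
      assume "t = 0"
      then have "[int (expo m Vz) = int 0] (mod int d)" "[int (expo m Vy) = int 0] (mod int d)"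
        using P cong_minus_minus_iff[of 0 "int (expo m Vy)" "int d"] by (simp_all add: P_def cong_sym)
      then have "expo m Vz = 0" "expo m Vy = 0" using small[OF m(1)] eqI by auto
      then show False using small[OF m(1)] by simp
    qed
    \<comment> \<open>For \<open>t \<equiv> - 1\<close> the exponents of \<open>y\<close> and
      \<open>z\<close> would be \<open>b\<close> and \<open>d - a\<close>, whose sum exceeds
      \<open>d\<close>.\<close>
    moreover have "t \<noteq> d - 1"
    proof
      assume t: "t = d - 1"
      have "[int (expo m Vz) = int (d - a)] (mod int d)" "[int (expo m Vy) = int b] (mod int d)"
      proof -
        have "int (expo m Vz) - int (d - a) = int d * (int a - 1) - (int t * int a - int (expo m Vz))"
          using t assms a_less_b b_less_d by (simp add: of_nat_diff algebra_simps)
        then show "[int (expo m Vz) = int (d - a)] (mod int d)"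
          using P unfolding P_def cong_iff_dvd_diff by (simp only: dvd_diff dvd_triv_left)
        have "int (expo m Vy) - int b = (int t * int b - (- int (expo m Vy))) - int d * int b"
          using t assms by (simp add: of_nat_diff algebra_simps)
        then show "[int (expo m Vy) = int b] (mod int d)"
          using P unfolding P_def cong_iff_dvd_diff by (simp only: dvd_diff dvd_triv_left)
      qed
      then have "expo m Vz = d - a" "expo m Vy = b"
        using small[OF m(1)] eqI a_pos b_less_d assms by auto
      moreover have "expo m Vx + expo m Vy + expo m Vz = d"
        using m(1) by (simp add: invariant_monomials_def mdeg_eq)
      ultimately show False using a_less_b b_less_d by linarith
    qed
    moreover have "t < d" using P by (simp add: P_def)
    ultimately show "t \<in> {1..d - 2}" by auto
  qed
  ultimately have "card (invariant_monomials - ?C) \<le> card {1..d - 2}"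
    by (rule card_inj_on_le) simp
  moreover have "card invariant_monomials \<le> card (invariant_monomials - ?C) + card ?C"
    by (rule order_trans[OF card_mono card_Un_le]) (use fin in auto)
  moreover have "card ?C \<le> 3" by (simp add: card_insert_if)
  ultimately show "card invariant_monomials \<le> d + 1" using assms by simp
qed

end

subsection \<open>The cyclic group action\<close>

locale cyclic_action = circulant_steps d a b for d a b :: nat +
  fixes e :: "'k :: field_char_0"
  assumes d_ge_3: "3 \<le> d" and root: "primitive_root_of_unity d e"
begin

definition weight :: "var \<Rightarrow> 'k" where
  "weight v = (case v of Vx \<Rightarrow> 1 | Vy \<Rightarrow> e ^ a | Vz \<Rightarrow> e ^ b)"

lemma prod_weight: "(\<Prod>v\<in>UNIV. weight v ^ expo m v) = e ^ (a * expo m Vy + b * expo m Vz)"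
  by (simp add: UNIV_var weight_def power_add flip: power_mult)

lemma weight_power_d: "weight v ^ d = 1"
proof -
  have "(e ^ n) ^ d = (e ^ d) ^ n" for n
    by (simp add: mult.commute flip: power_mult)
  then have "(e ^ n) ^ d = 1" for n using root by (simp add: primitive_root_of_unity_def)
  then show ?thesis by (cases v) (simp_all add: weight_def)
qed

lemma diag_invariant_iff_dvd:
  "diag_invariant weight p \<longleftrightarrow> (\<forall>m\<in>Poly_Mapping.keys p. d dvd a * expo m Vy + b * expo m Vz)"
  by (simp add: diag_invariant_iff prod_weight primitive_root_power_eq_1_iff[OF root])

lemma invariant_form_keys:
  assumes "form d p"
  shows "diag_invariant weight p \<longleftrightarrow> Poly_Mapping.keys p \<subseteq> invariant_monomials"
  using assms by (auto simp: diag_invariant_iff_dvd invariant_monomials_def form_def)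

abbreviation orbit_form :: "'k poly3 \<Rightarrow> nat \<Rightarrow> 'k poly3" where
  "orbit_form L j \<equiv> diag_act (\<lambda>v. weight v ^ j) L"

text \<open>The generator sends each translate of \<open>L\<close> to the next one, and the last
  returns to the first because \<open>weight v ^ d = 1\<close>.\<close>

lemma diag_invariant_prod: "diag_invariant weight (\<Prod>j\<in>{0..<d}. orbit_form L j)"
proof -
  obtain n where n: "d = Suc n" using d_ge_3 by (cases d) auto
  have "diag_act weight (\<Prod>j\<in>{0..<d}. orbit_form L j) = (\<Prod>j<d. orbit_form L (Suc j))"
    by (simp add: diag_act_prod diag_act_compose atLeast0LessThan)
  also have "\<dots> = (\<Prod>j<n. orbit_form L (Suc j)) * orbit_form L d"
    unfolding n by simp
  also have "orbit_form L d = orbit_form L 0" by (simp add: weight_power_d)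
  also have "(\<Prod>j<n. orbit_form L (Suc j)) * orbit_form L 0 = (\<Prod>j\<in>{0..<d}. orbit_form L j)"
    unfolding n atLeast0LessThan prod.lessThan_Suc_shift by (simp only: mult.commute)
  finally show ?thesis by (simp only: diag_invariant_def)
qed

abbreviation inv_ideal :: "'k poly3 set" where "inv_ideal \<equiv> Idl\<^bsub>polyring\<^esub> (mon ` invariant_monomials)"

lemma mdeg_invariant: "s \<in> invariant_monomials \<Longrightarrow> mdeg s = d"
  by (simp add: invariant_monomials_def)

lemma orbit_form_nonzero:
  assumes "L \<noteq> 0"
  shows "orbit_form L j \<noteq> 0"
proof
  assume 0: "orbit_form L j = 0"
  obtain m where "Poly_Mapping.lookup L m \<noteq> 0"
    using assms by (metis lookup_zero poly_mapping_eqI)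
  moreover have "(\<Prod>v\<in>UNIV. (weight v ^ j) ^ expo m v) \<noteq> 0"
    using weight_power_d d_ge_3 by (simp add: prod_zero_iff) (metis not_numeral_le_zero power_0_left zero_neq_one)
  ultimately have "Poly_Mapping.lookup (orbit_form L j) m \<noteq> 0"
    by (simp add: lookup_diag_act)
  then show False using 0 by simp
qed

text \<open>The kernel element is the norm of \<open>L\<close> divided by \<open>L\<close>.\<close>

lemma ex_kernel:
  assumes L: "form 1 L"
  shows "\<exists>f. form (d - 1) f \<and> f \<noteq> 0 \<and> L * f \<in> inv_ideal"
proof (cases "L = 0")
  case True
  \<comment> \<open>For \<open>L = 0\<close> any nonzero form of degree \<open>d - 1\<close> lies in
    the kernel.\<close>
  have "0 \<in> inv_ideal" unfolding Idl_monomials by simp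
  moreover have "mon (mk3 (d - 1) 0 0) \<noteq> (0 :: 'k poly3)" by (metis lookup_single_eq lookup_zero zero_neq_one)
  ultimately show ?thesis
    using True by (intro exI[of _ "mon (mk3 (d - 1) 0 0)"]) simp
next
  case False
  define f where "f = (\<Prod>j\<in>{1..<d}. orbit_form L j)"
  have forms: "form 1 (orbit_form L j)" for j by (rule form_diag_act[OF L])
  have f: "form (d - 1) f" using form_prod[of "{1..<d}" "orbit_form L"] forms by (simp add: f_def)
  have "{0..<d} = insert 0 {1..<d}" using d_ge_3 by auto
  then have Lf: "L * f = (\<Prod>j\<in>{0..<d}. orbit_form L j)" by (simp add: f_def)
  have "form d (L * f)" using form_mult[OF L f] d_ge_3 by simp
  moreover have "diag_invariant weight (L * f)" unfolding Lf by (rule diag_invariant_prod)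
  ultimately have "L * f \<in> inv_ideal"
    using form_in_Idl_iff[of d "L * f" invariant_monomials] invariant_form_keys mdeg_invariant by blast
  \<comment> \<open>Dehomogenisation is injective on forms, so the factors can be examined in an
    integral domain of iterated polynomials.\<close>
  moreover have "f \<noteq> 0"
  proof
    assume "f = 0"
    then have "(\<Prod>j\<in>{1..<d}. dehom (orbit_form L j)) = 0"
      using dehom_prod[of "orbit_form L" "{1..<d}"] by (simp add: f_def dehom_0)
    then obtain j where "dehom (orbit_form L j) = 0" by (auto simp: prod_zero_iff)
    then show False using dehom_eq_0[OF forms] orbit_form_nonzero[OF False] by blast
  qed
  ultimately show ?thesis using f by blast
qed

lemma not_WLP: "\<not> WLP_in_degree inv_ideal (d - 1)"
proof
  assume "WLP_in_degree inv_ideal (d - 1)"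
  then obtain L where L: "form 1 L" "max_rank_at inv_ideal (d - 1) L" by (auto simp: WLP_in_degree_def)
  obtain f where f: "form (d - 1) f" "f \<noteq> 0" "L * f \<in> inv_ideal" using ex_kernel[OF L(1)] by blast
  have "\<not> max_rank_at inv_ideal (d - 1) L"
    by (rule not_max_rank_at[OF _ _ L(1) f]) (use mdeg_invariant card_invariant_monomials[OF d_ge_3] d_ge_3 in auto)
  then show False using L(2) by contradiction
qed

lemma monomial_togliatti_inv_ideal: "monomial_togliatti_system d inv_ideal"
proof -
  have "mk3 d 0 0 \<in> invariant_monomials" "mk3 0 d 0 \<in> invariant_monomials" "mk3 0 0 d \<in> invariant_monomials"
    by (simp_all add: invariant_monomials_def)
  then have "artinian_ideal inv_ideal" by (rule artinian_monomial_ideal)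
  moreover have "card (mon ` invariant_monomials :: 'k poly3 set) \<le> d + 1"
    using card_image_le[of invariant_monomials "mon :: _ \<Rightarrow> 'k poly3"] card_invariant_monomials[OF d_ge_3] by linarith
  then have "\<exists>F :: 'k poly3 set. finite F \<and> card F \<le> d + 1 \<and> (\<forall>f\<in>F. form d f) \<and> inv_ideal = Idl\<^bsub>polyring\<^esub> F"
    using card_invariant_monomials(1)[OF d_ge_3] mdeg_invariant
    by (intro exI[of _ "mon ` invariant_monomials"]) auto
  ultimately have "togliatti_system d inv_ideal" using not_WLP by (simp add: togliatti_system_def)
  moreover have "\<exists>G. (\<forall>g\<in>G. is_monomial g) \<and> inv_ideal = Idl\<^bsub>polyring\<^esub> G"
    by (intro exI[of _ "mon ` invariant_monomials"]) (auto simp: is_monomial_def)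
  ultimately show ?thesis by (simp add: monomial_togliatti_system_def)
qed

section \<open>Minimality\<close>

definition sum_of_variables :: "'k poly3" where
  "sum_of_variables = mon (mk3 1 0 0) + mon (mk3 0 1 0) + mon (mk3 0 0 1)"

lemma form_sum_of_variables: "form 1 sum_of_variables"
  unfolding sum_of_variables_def by (intro form_add) simp_all

lemma dehom_orbit_form_sum:
  "dehom (orbit_form sum_of_variables j) = [:[:e ^ (b * j), e ^ (a * j):], 1:]"
proof -
  have "orbit_form sum_of_variables j = mon (mk3 1 0 0) + Poly_Mapping.single (mk3 0 1 0) (e ^ (a * j))
      + Poly_Mapping.single (mk3 0 0 1) (e ^ (b * j))"
    by (rule poly_mapping_eqI)
      (auto simp: sum_of_variables_def lookup_diag_act lookup_add lookup_single when_def UNIV_var weight_def power_mult)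
  then show ?thesis by (simp add: dehom_add dehom_single monom_Suc monom_0 one_pCons)
qed

text \<open>
  The product \<open>Q\<close> is invariant and divisible by \<open>x + y + z\<close>, hence by all its translates: it is
  a multiple of the norm of \<open>x + y + z\<close>, in which every invariant monomial occurs.
\<close>

lemma kernel_trivial:
  assumes sub: "S \<subset> invariant_monomials"
    and f: "form (d - 1) f" and Lf: "sum_of_variables * f \<in> Idl\<^bsub>polyring\<^esub> (mon ` S)"
  shows "f = 0"
proof -
  let ?P = "\<Prod>j\<in>{0..<d}. [:[:e ^ (b * j), e ^ (a * j):], 1:]"
  define Q where "Q = sum_of_variables * f"
  have Q: "form d Q"
    using form_mult[OF form_sum_of_variables f] d_ge_3 by (simp add: Q_def)
  have keys: "Poly_Mapping.keys Q \<subseteq> S"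
    using form_in_Idl_iff[OF Q, of S] sub mdeg_invariant Lf by (auto simp: Q_def)
  have inv: "orbit_form Q j = Q" for j
  proof (rule poly_mapping_eqI)
    fix m
    have "(\<Prod>v\<in>UNIV. (weight v ^ j) ^ expo m v) = (\<Prod>v\<in>UNIV. weight v ^ expo m v) ^ j"
      by (simp add: prod_power_distrib mult.commute flip: power_mult)
    moreover have "e ^ (a * expo m Vy + b * expo m Vz) = 1" if "m \<in> Poly_Mapping.keys Q"
      using keys sub that by (auto simp: invariant_monomials_def primitive_root_power_eq_1_iff[OF root])
    ultimately show "Poly_Mapping.lookup (orbit_form Q j) m = Poly_Mapping.lookup Q m"
      by (cases "m \<in> Poly_Mapping.keys Q") (simp_all add: lookup_diag_act prod_weight in_keys_iff)
  qed
  have "poly (dehom Q) (- [:e ^ (b * j), e ^ (a * j):]) = 0" for j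
  proof -
    \<comment> \<open>The \<open>j\<close>-th group element fixes \<open>Q\<close> and replaces its
      factor \<open>sum_of_variables\<close> by a translate.\<close>
    have "dehom Q = dehom (orbit_form sum_of_variables j) * dehom (orbit_form f j)"
      using inv[of j] by (simp add: Q_def diag_act_mult dehom_mult flip: dehom_mult)
    then show ?thesis by (simp add: dehom_orbit_form_sum)
  qed
  then have eq: "dehom Q = Polynomial.smult (coeff (dehom Q) d) ?P"
    by (rule eq_smult_prod_linear_forms[OF root degree_dehom_le[OF Q]])
  define c where "c = Poly_Mapping.lookup Q (mk3 d 0 0)"
  \<comment> \<open>A priori this coefficient is a polynomial in \<open>y\<close>; it is constant
    because a term of degree \<open>d\<close> containing \<open>x ^ d\<close> contains no
    \<open>y\<close>.\<close>
  have "coeff (dehom Q) d = [:c:]"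
  proof (rule poly_eqI)
    fix j
    show "coeff (coeff (dehom Q) d) j = coeff [:c:] j"
    proof (cases j)
      case 0
      then show ?thesis using coeff_dehom[OF Q, of "mk3 d 0 0"] by (simp add: c_def)
    next
      case (Suc i)
      have "coeff (coeff (dehom Q) d) j = (\<Sum>k\<in>Poly_Mapping.keys Q. 0)"
        unfolding dehom_def mono_ext_def coeff_sum
      proof (rule sum.cong[OF refl])
        fix k assume "k \<in> Poly_Mapping.keys Q"
        then have "mdeg k = d" using Q by (simp add: form_def)
        then show "coeff (coeff (monom (monom (Poly_Mapping.lookup Q k) (expo k Vy)) (expo k Vx)) d) j = 0"
          using Suc by (auto simp: mdeg_eq)
      qed
      then show ?thesis using Suc by simp
    qed
  qed
  then have eq: "dehom Q = Polynomial.smult [:c:] ?P" using eq by simp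
  obtain m where m: "m \<in> invariant_monomials" "m \<notin> S" using sub by blast
  have deg: "expo m Vx + expo m Vy + expo m Vz = d" and dvd: "d dvd a * expo m Vy + b * expo m Vz"
    using m(1) by (auto simp: invariant_monomials_def mdeg_eq)
  \<comment> \<open>At an invariant monomial outside \<open>S\<close> the norm has a nonzero
    coefficient while that of \<open>Q\<close> is zero, which forces \<open>c = 0\<close>.\<close>
  have "c * coeff (coeff ?P (expo m Vx)) (expo m Vy) = coeff (coeff (dehom Q) (expo m Vx)) (expo m Vy)"
    unfolding eq by simp
  also have "\<dots> = Poly_Mapping.lookup Q m"
    by (rule coeff_dehom[OF Q mdeg_invariant[OF m(1)]])
  also have "\<dots> = 0" using keys m(2) by (auto simp: in_keys_iff)
  finally have "c = 0"
    using coeff_prod_linear_forms_nonzero[OF root deg dvd] by simp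
  then have "dehom (orbit_form sum_of_variables 0) * dehom f = 0"
    using eq by (simp add: Q_def flip: dehom_mult)
  then have "dehom f = 0" unfolding dehom_orbit_form_sum mult_eq_0_iff by simp
  then show "f = 0" by (rule dehom_eq_0[OF f])
qed

text \<open>By \<open>kernel_trivial\<close> multiplication by \<open>x + y + z\<close> is
  injective, and one linear form of maximal rank is what \<open>WLP_in_degree\<close> asks
  for.\<close>

lemma WLP_proper_subset:
  assumes sub: "S \<subset> invariant_monomials"
  shows "WLP_in_degree (Idl\<^bsub>polyring\<^esub> (mon ` S) :: 'k poly3 set) (d - 1)"
proof -
  let ?J = "Idl\<^bsub>polyring\<^esub> (mon ` S) :: 'k poly3 set"
  have J: "ideal ?J polyring" by (rule polyring.genideal_ideal) simp
  have "inj_on (mult_class ?J sum_of_variables) (quot_component ?J (d - 1))"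
  proof (rule inj_onI)
    fix u w assume "u \<in> quot_component ?J (d - 1)" "w \<in> quot_component ?J (d - 1)"
      and eq: "mult_class ?J sum_of_variables u = mult_class ?J sum_of_variables w"
    then obtain f g where fg: "form (d - 1) f" "u = ?J +>\<^bsub>polyring\<^esub> f" "form (d - 1) g" "w = ?J +>\<^bsub>polyring\<^esub> g"
      by (auto simp: quot_component_def)
    have "sum_of_variables * (f - g) \<in> ?J"
      using eq unfolding fg mult_class_coset[OF J] coset_eq_iff[OF J] by (simp add: right_diff_distrib)
    then have "f - g = 0" by (rule kernel_trivial[OF sub form_minus[OF fg(1,3)]])
    then show "u = w" using fg by simp
  qed
  then show ?thesis
    using form_sum_of_variables by (auto simp: WLP_in_degree_def max_rank_at_def)
qed

text \<open>Every monomial of degree \<open>d\<close> in the ideal is invariant, so a proper subset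
  of a generating set \<open>G\<close> corresponds to a proper subset of
  \<open>invariant_monomials\<close>.\<close>

lemma minimal_inv_ideal: "minimal_monomial_togliatti_system d inv_ideal"
  unfolding minimal_monomial_togliatti_system_def
proof (intro conjI allI impI monomial_togliatti_inv_ideal)
  fix G H :: "'k poly3 set"
  assume GH: "(\<forall>g\<in>G. is_monomial g \<and> form d g) \<and> inv_ideal = Idl\<^bsub>polyring\<^esub> G \<and> H \<subset> G"
  define S where "S = {m. mon m \<in> H}"
  have H: "H = mon ` S" using GH by (force simp: S_def is_monomial_def)
  have G_inv: "m \<in> invariant_monomials" if "mon m \<in> G" for m
  proof -
    have "mon m \<in> inv_ideal" using GH that polyring.genideal_self[of G] by auto
    moreover have "form d (mon m :: 'k poly3)" using GH that by blast
    ultimately show ?thesis using form_in_Idl_iff[of d "mon m :: 'k poly3" invariant_monomials] mdeg_invariant by auto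
  qed
  obtain g where g: "g \<in> G" "g \<notin> H" using GH by blast
  then obtain m where "g = mon m" using GH by (auto simp: is_monomial_def)
  with g have "mon m \<in> G" "m \<notin> S" by (auto simp: S_def)
  then have "S \<subset> invariant_monomials" using G_inv GH by (auto simp: S_def)
  then have "WLP_in_degree (Idl\<^bsub>polyring\<^esub> H) (d - 1)" unfolding H by (rule WLP_proper_subset)
  then show "\<not> monomial_togliatti_system d (Idl\<^bsub>polyring\<^esub> H)"
    by (simp add: monomial_togliatti_system_def togliatti_system_def)
qed

section \<open>Identification with the ideal generated by the invariants\<close>

lemma invariant_monomial_ideal_eq: "invariant_monomial_ideal d weight = inv_ideal"
proof -
  have "{f. is_monomial f \<and> form d f \<and> diag_invariant weight f} = mon ` invariant_monomials"
    by (auto simp: is_monomial_def invariant_form_keys invariant_monomials_def diag_invariant_iff_dvd)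
  then show ?thesis by (simp add: invariant_monomial_ideal_def)
qed

text \<open>The support of an invariant form of degree \<open>d\<close> consists of invariant
  monomials, so both generate the same ideal, and counting the monomials bounds the number of
  generators.\<close>

lemma GT_system_inv_ideal: "GT_system d inv_ideal"
proof -
  define \<alpha> where "\<alpha> v = (case v of Vx \<Rightarrow> 0 | Vy \<Rightarrow> a | Vz \<Rightarrow> b)" for v
  have w: "weight = (\<lambda>v. e ^ \<alpha> v)" by (rule ext) (simp add: weight_def \<alpha>_def split: var.split)
  let ?F = "{f. form d f \<and> diag_invariant (\<lambda>v. e ^ \<alpha> v) f}"
  have "inv_ideal = Idl\<^bsub>polyring\<^esub> ?F"
  proof
    show "inv_ideal \<subseteq> Idl\<^bsub>polyring\<^esub> ?F"
      by (rule polyring.subset_Idl_subset)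
        (auto simp: invariant_monomials_def diag_invariant_iff_dvd simp flip: w)
    show "Idl\<^bsub>polyring\<^esub> ?F \<subseteq> inv_ideal"
    proof (rule polyring.genideal_minimal)
      show "ideal inv_ideal polyring" by (rule polyring.genideal_ideal) simp
      show "?F \<subseteq> inv_ideal"
        using form_in_Idl_iff[of d _ invariant_monomials] invariant_form_keys mdeg_invariant
        unfolding w[symmetric] by blast
    qed
  qed
  moreover have "Gcd {\<alpha> Vx, \<alpha> Vy, \<alpha> Vz, d} = 1"
    using coprime_abd by (simp add: \<alpha>_def)
  moreover have "min_num_generators inv_ideal \<le> d + 1"
  proof -
    have "min_num_generators inv_ideal \<le> card (mon ` invariant_monomials :: 'k poly3 set)"
      unfolding min_num_generators_def using card_invariant_monomials(1)[OF d_ge_3] by (intro Least_le) blast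
    also have "\<dots> \<le> card invariant_monomials"
      by (rule card_image_le[OF card_invariant_monomials(1)[OF d_ge_3]])
    finally show ?thesis using card_invariant_monomials(2)[OF d_ge_3] by simp
  qed
  ultimately show ?thesis using root unfolding GT_system_def by blast
qed

end

theorem theorem3p8:
  fixes e :: "'k :: {alg_closed_field, field_char_0}"
    and d a b :: nat
    and M :: "var \<Rightarrow> 'k"
    and I :: "'k poly3 set"
  assumes "d \<ge> 3"
    and "1 \<le> a" and "a < b" and "b \<le> d - 1"
    and "Gcd {a, b, d} = 1"
    and "primitive_root_of_unity d e"
    and "M = (\<lambda>v. case v of Vx \<Rightarrow> 1 | Vy \<Rightarrow> e ^ a | Vz \<Rightarrow> e ^ b)"
    and "I = invariant_monomial_ideal d M"
  shows "GT_system d I \<and> monomial_togliatti_system d I \<and> minimal_monomial_togliatti_system d I"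
proof -
  interpret act: cyclic_action d a b e
    by unfold_locales (use assms in auto)
  have "M = act.weight" using assms(7) by (simp add: act.weight_def fun_eq_iff)
  then have "I = act.inv_ideal" using assms(8) act.invariant_monomial_ideal_eq by simp
  then show ?thesis using act.GT_system_inv_ideal act.monomial_togliatti_inv_ideal act.minimal_inv_ideal by simp
qed

end
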